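(* Consider superfunctions on the genus $2$ super Siegel plane $S\mathfrak H_2$ as sections of the line bundle $S\mathcal L_{1/2}$. Then $\mathbb D=D_1D_2-D_2D_1$ defines an $\mathrm{OMp}(1|4)$-skew-invariant differential operator $\mathbb D:S\mathcal L_{1/2}\to S\mathcal L_{3/2}$ between equivariant line bundles on $S\mathfrak H_2$. In other words, the operator $(-1)^{\mathrm F}\mathbb D$ is a morphism of $\mathrm{OMp}(1|4)$-modules.
   Context: $\mathfrak H_2$ is the set of complex symmetric $2\times2$ matrices $v$ with positive definite imaginary part; $S\mathfrak H_2$ is the supermanifold with underlying manifold $\mathfrak H_2$ and structure sheaf $\mathcal O_{\mathfrak H_2}\otimes\Lambda[\xi_1,\xi_2]$. Write $T=\|t_{ij}\|$ with $t_{ij}=v_{ij}-\frac12\xi_i\xi_j$ (so $t_{12}-t_{21}+\xi_1\xi_2=0$) and $\xi=(\xi_1,\xi_2)$ (row vector). Put $\partial_{ii}=\partial/\partial v_{ii}$, $\partial_{12}=\partial_{21}=\frac12\,\partial/\partial v_{12}$ and $D_i=\frac{\partial}{\partial\xi_i}-\sum_j\xi_j\partial_{ij}$. $(-1)^{\mathrm F}$ is the parity operator: $+1$ on even, $-1$ on odd superfunctions. For $r\in\frac12\mathbb Z$, sections of $S\mathcal L_r$ are represented by superfunctions $\Phi(T,\xi)$. The real Lie supergroup $\mathrm{OMp}(1|4)$ acts on them as a (super) Harish-Chandra pair, as follows. The underlying group $\{\pm1\}\times\mathrm{Mp}(4)$ consists of triples $(s,g,\phi)$ with $s=\pm1$,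 $g=\begin{pmatrix}A&B\\C&D\end{pmatrix}\in\mathrm{Sp}(4,\mathbb R)$ and $\phi$ an even superfunction on $S\mathfrak H_2$ with $\phi^2=\det(CT+D)$, and acts by $\Phi(T,\xi)\mapsto\phi^{-2r}\,\Phi\big((AT+B)(CT+D)^{-1},\,s\,\xi(CT+D)^{-1}\big)$. The complexified Lie superalgebra is $\mathfrak{osp}(1|4)$, generated by its odd part with basis $p_1,p_2,q_1,q_2$, which acts by $D^{(r)}_{p_i}=D_i$, $D^{(r)}_{q_i}=\sum_jt_{ji}D_j-r\xi_i$. A skew-invariant operator $S\mathcal L_r\to S\mathcal L_{r'}$ is an even operator $P$ that commutes with the action of the underlying even group and satisfies $D^{(r')}_yP=-P\,D^{(r)}_y$ for every odd $y\in\mathfrak{osp}(1|4)_{\bar1}$; equivalently $(-1)^{\mathrm F}P$ intertwines the two actions. *)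

theory Defs
  imports "HOL-Analysis.Analysis"
begin

(* Grass a b c d stands for a + b xi_1 + c xi_2 + d xi_1 xi_2 in the exterior algebra
   \<Lambda>[xi_1, xi_2] over the complex numbers. *)
datatype grass = Grass (c0: complex) (c1: complex) (c2: complex) (c12: complex)

instantiation grass :: ring_1
begin
definition "0 = Grass 0 0 0 0"
definition "1 = Grass 1 0 0 0"
definition "x + y = Grass (c0 x + c0 y) (c1 x + c1 y) (c2 x + c2 y) (c12 x + c12 y)"
definition "- x = Grass (- c0 x) (- c1 x) (- c2 x) (- c12 x)"
definition "x - y = Grass (c0 x - c0 y) (c1 x - c1 y) (c2 x - c2 y) (c12 x - c12 y)"
definition "x * y = Grass (c0 x * c0 y)
   (c0 x * c1 y + c1 x * c0 y)
   (c0 x * c2 y + c2 x * c0 y)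
   (c0 x * c12 y + c12 x * c0 y + c1 x * c2 y - c2 x * c1 y)"
instance
  by standard
     (auto simp: zero_grass_def one_grass_def plus_grass_def uminus_grass_def minus_grass_def
       times_grass_def algebra_simps)
end

(* If c0 x is nonzero, this is the two-sided inverse of x, because x - c0 x squares to zero. *)
instantiation grass :: inverse
begin
definition "inverse x = Grass (inverse (c0 x)) (- c1 x / (c0 x)\<^sup>2) (- c2 x / (c0 x)\<^sup>2) (- c12 x / (c0 x)\<^sup>2)"
definition "x div (y::grass) = x * inverse y"
instance ..
end

definition gconst :: "complex \<Rightarrow> grass" where
  "gconst a = Grass a 0 0 0"

definition even_grass :: "grass \<Rightarrow> bool" where
  "even_grass x \<longleftrightarrow> c1 x = 0 \<and> c2 x = 0"

definition odd_grass :: "grass \<Rightarrow> bool" where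
  "odd_grass x \<longleftrightarrow> c0 x = 0 \<and> c12 x = 0"

(* The index type 2 has the elements 1 and 2 (where 2 = 0). *)
definition xi :: "grass^2" where
  "xi = (\<chi> i. if i = 1 then Grass 0 1 0 0 else Grass 0 0 1 0)"

definition siegel :: "(complex^2^2) set" where
  "siegel = {v. transpose v = v \<and> (\<forall>x::real^2. x \<noteq> 0 \<longrightarrow> x \<bullet> (map_matrix Im v *v x) > 0)}"

(* Complex differentiability at every point of siegel, as a function on the (complex
   three-dimensional) space of symmetric matrices: siegel is open in that space, and every complex
   linear form on it is w \<mapsto> \<Sum>i j. a_ij w_ij for some matrix a. *)
definition holomorphic_siegel :: "(complex^2^2 \<Rightarrow> complex) \<Rightarrow> bool" where
  "holomorphic_siegel f \<longleftrightarrow>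
     (\<forall>v\<in>siegel. \<exists>a::complex^2^2.
        (f has_derivative (\<lambda>w. \<Sum>i\<in>UNIV. \<Sum>j\<in>UNIV. a$i$j * w$i$j)) (at v within siegel))"

(* A superfunction is given by its four coefficient functions of v; its values outside siegel are
   irrelevant. *)
type_synonym superfun = "complex^2^2 \<Rightarrow> grass"

definition superfunctions :: "superfun set" where
  "superfunctions = {F. holomorphic_siegel (c0 \<circ> F) \<and> holomorphic_siegel (c1 \<circ> F) \<and>
                        holomorphic_siegel (c2 \<circ> F) \<and> holomorphic_siegel (c12 \<circ> F)}"

definition even_superfun :: "superfun \<Rightarrow> bool" where
  "even_superfun F \<longleftrightarrow> (\<forall>v\<in>siegel. even_grass (F v))"

definition odd_superfun :: "superfun \<Rightarrow> bool" where
  "odd_superfun F \<longleftrightarrow> (\<forall>v\<in>siegel. odd_grass (F v))"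

definition parity :: "superfun \<Rightarrow> superfun" where
  "parity F = (\<lambda>v. Grass (c0 (F v)) (- c1 (F v)) (- c2 (F v)) (c12 (F v)))"

definition smat :: "complex \<Rightarrow> complex^2^2 \<Rightarrow> complex^2^2" where
  "smat z n = map_matrix (\<lambda>a. z * a) n"

(* The direction of the coordinate v_ij: for i \<noteq> j both off-diagonal entries move. *)
definition coord_dir :: "2 \<Rightarrow> 2 \<Rightarrow> complex^2^2" where
  "coord_dir i j = (\<chi> k l. if (k = i \<and> l = j) \<or> (k = j \<and> l = i) then 1 else 0)"

(* \<partial>_ii is the derivative along v_ii, and \<partial>_12 = \<partial>_21 is half the derivative along v_12. *)
definition pd :: "2 \<Rightarrow> 2 \<Rightarrow> (complex^2^2 \<Rightarrow> complex) \<Rightarrow> complex^2^2 \<Rightarrow> complex" where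
  "pd i j f v = (if i = j then 1 else 1/2) * deriv (\<lambda>z. f (v + smat z (coord_dir i j))) 0"

definition dv :: "2 \<Rightarrow> 2 \<Rightarrow> superfun \<Rightarrow> superfun" where
  "dv i j F = (\<lambda>v. Grass (pd i j (c0 \<circ> F) v) (pd i j (c1 \<circ> F) v)
                         (pd i j (c2 \<circ> F) v) (pd i j (c12 \<circ> F) v))"

(* The left derivative: xi_i is moved to the front and removed. *)
definition dxi :: "2 \<Rightarrow> superfun \<Rightarrow> superfun" where
  "dxi i F = (\<lambda>v. if i = 1 then Grass (c1 (F v)) 0 (c12 (F v)) 0
                           else Grass (c2 (F v)) (- c12 (F v)) 0 0)"

definition Dop :: "2 \<Rightarrow> superfun \<Rightarrow> superfun" where
  "Dop i F = (\<lambda>v. dxi i F v - (\<Sum>j\<in>UNIV. xi$j * dv i j F v))"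

definition Tmat :: "complex^2^2 \<Rightarrow> grass^2^2" where
  "Tmat v = (\<chi> i j. gconst (v$i$j) - gconst (1/2) * (xi$i * xi$j))"

(* The value of a holomorphic function at an even matrix V = b + n xi_1 xi_2, i.e. the Taylor
   expansion at b, which stops after the linear term. *)
definition geval :: "(complex^2^2 \<Rightarrow> complex) \<Rightarrow> grass^2^2 \<Rightarrow> grass" where
  "geval f V = (let b = map_matrix c0 V; n = map_matrix c12 V in
     Grass (f b) 0 0 (deriv (\<lambda>z. f (b + smat z n)) 0))"

(* The superfunction F, regarded as a function of (T, xi), at T = T' and xi = x. The corresponding
   coordinate matrix v has the entries T'_ij + x_i x_j / 2. *)
definition superval :: "superfun \<Rightarrow> grass^2^2 \<Rightarrow> grass^2 \<Rightarrow> grass" where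
  "superval F T' x = (let V = (\<chi> i j. T'$i$j + gconst (1/2) * (x$i * x$j)) in
     geval (c0 \<circ> F) V + geval (c1 \<circ> F) V * x$1 + geval (c2 \<circ> F) V * x$2
       + geval (c12 \<circ> F) V * (x$1 * x$2))"

definition symplectic_form :: "real^(2+2)^(2+2)" where
  "symplectic_form = (\<chi> i j. case (i, j) of
       (Inl k, Inr l) \<Rightarrow> (if k = l then 1 else 0)
     | (Inr k, Inl l) \<Rightarrow> (if k = l then - 1 else 0)
     | _ \<Rightarrow> 0)"

definition Sp4 :: "(real^(2+2)^(2+2)) set" where
  "Sp4 = {g. transpose g ** symplectic_form ** g = symplectic_form}"

definition block :: "(2 \<Rightarrow> 2 + 2) \<Rightarrow> (2 \<Rightarrow> 2 + 2) \<Rightarrow> real^(2+2)^(2+2) \<Rightarrow> grass^2^2" where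
  "block p q g = (\<chi> i j. gconst (of_real (g $ p i $ q j)))"

abbreviation "blockA \<equiv> block Inl Inl"
abbreviation "blockB \<equiv> block Inl Inr"
abbreviation "blockC \<equiv> block Inr Inl"
abbreviation "blockD \<equiv> block Inr Inr"

definition aut :: "real^(2+2)^(2+2) \<Rightarrow> complex^2^2 \<Rightarrow> grass^2^2" where
  "aut g v = blockC g ** Tmat v + blockD g"

(* Needed because det in the library requires a commutative ring; the entries will be even. *)
definition gdet :: "grass^2^2 \<Rightarrow> grass" where
  "gdet M = M$1$1 * M$2$2 - M$1$2 * M$2$1"

(* The underlying group {1,-1} x Mp(4) of OMp(1|4). *)
definition OMp_even :: "(real \<times> (real^(2+2)^(2+2)) \<times> superfun) set" where
  "OMp_even = {(s, g, \<phi>). s \<in> {1, - 1} \<and> g \<in> Sp4 \<and> \<phi> \<in> superfunctions \<and> even_superfun \<phi> \<and>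
                (\<forall>v\<in>siegel. (\<phi> v)\<^sup>2 = gdet (aut g v))}"

(* The parameter r is half-integral, so the exponent is exactly - 2 r. *)
definition group_act :: "real \<Rightarrow> real \<times> (real^(2+2)^(2+2)) \<times> superfun \<Rightarrow> superfun \<Rightarrow> superfun" where
  "group_act r = (\<lambda>(s, g, \<phi>) F v.
     \<phi> v powi (- \<lfloor>2 * r\<rfloor>) *
     superval F ((blockA g ** Tmat v + blockB g) ** matrix_inv (aut g v))
                (gconst (of_real s) *s (xi v* matrix_inv (aut g v))))"

definition Dq :: "real \<Rightarrow> 2 \<Rightarrow> superfun \<Rightarrow> superfun" where
  "Dq r i F = (\<lambda>v. (\<Sum>j\<in>UNIV. Tmat v$j$i * Dop j F v) - gconst (of_real r) * xi$i * F v)"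

(* An element of the odd part of osp(1|4) is a pair (a, b), standing for
   a_1 p_1 + a_2 p_2 + b_1 q_1 + b_2 q_2. *)
definition odd_act :: "real \<Rightarrow> (complex^2) \<times> (complex^2) \<Rightarrow> superfun \<Rightarrow> superfun" where
  "odd_act r = (\<lambda>(a, b) F v.
     (\<Sum>i\<in>UNIV. gconst (a$i) * Dop i F v) + (\<Sum>i\<in>UNIV. gconst (b$i) * Dq r i F v))"

(* The action of the even element [y, y'], where y and y' are odd; such elements span the even
   part of osp(1|4). *)
definition bracket_act ::
  "real \<Rightarrow> (complex^2) \<times> (complex^2) \<Rightarrow> (complex^2) \<times> (complex^2) \<Rightarrow> superfun \<Rightarrow> superfun" where
  "bracket_act r y y' F = (\<lambda>v. odd_act r y (odd_act r y' F) v + odd_act r y' (odd_act r y F) v)"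

definition eq_on_siegel :: "superfun \<Rightarrow> superfun \<Rightarrow> bool" (infix \<open>\<doteq>\<close> 50) where
  "F \<doteq> G \<longleftrightarrow> (\<forall>v\<in>siegel. F v = G v)"

(* A complex linear operator of even parity on superfunctions. *)
definition even_operator :: "(superfun \<Rightarrow> superfun) \<Rightarrow> bool" where
  "even_operator P \<longleftrightarrow>
     (\<forall>F\<in>superfunctions. P F \<in> superfunctions) \<and>
     (\<forall>F\<in>superfunctions. \<forall>G\<in>superfunctions. F \<doteq> G \<longrightarrow> P F \<doteq> P G) \<and>
     (\<forall>F\<in>superfunctions. \<forall>G\<in>superfunctions. P (\<lambda>v. F v + G v) \<doteq> (\<lambda>v. P F v + P G v)) \<and>
     (\<forall>a. \<forall>F\<in>superfunctions. P (\<lambda>v. gconst a * F v) \<doteq> (\<lambda>v. gconst a * P F v)) \<and>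
     (\<forall>F\<in>superfunctions. even_superfun F \<longrightarrow> even_superfun (P F)) \<and>
     (\<forall>F\<in>superfunctions. odd_superfun F \<longrightarrow> odd_superfun (P F))"

inductive super_diff_op :: "(superfun \<Rightarrow> superfun) \<Rightarrow> bool" where
  mult: "f \<in> superfunctions \<Longrightarrow> super_diff_op (\<lambda>F v. f v * F v)"
| dv: "super_diff_op (dv i j)"
| dxi: "super_diff_op (dxi i)"
| add: "super_diff_op P \<Longrightarrow> super_diff_op Q \<Longrightarrow> super_diff_op (\<lambda>F v. P F v + Q F v)"
| comp: "super_diff_op P \<Longrightarrow> super_diff_op Q \<Longrightarrow> super_diff_op (P \<circ> Q)"

definition group_equivariant :: "real \<Rightarrow> real \<Rightarrow> (superfun \<Rightarrow> superfun) \<Rightarrow> bool" where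
  "group_equivariant r r' P \<longleftrightarrow>
     (\<forall>\<gamma>\<in>OMp_even. \<forall>F\<in>superfunctions. group_act r' \<gamma> (P F) \<doteq> P (group_act r \<gamma> F))"

definition skew_invariant :: "real \<Rightarrow> real \<Rightarrow> (superfun \<Rightarrow> superfun) \<Rightarrow> bool" where
  "skew_invariant r r' P \<longleftrightarrow> even_operator P \<and> group_equivariant r r' P \<and>
     (\<forall>y. \<forall>F\<in>superfunctions. odd_act r' y (P F) \<doteq> (\<lambda>v. - P (odd_act r y F) v))"

definition OMp_morphism :: "real \<Rightarrow> real \<Rightarrow> (superfun \<Rightarrow> superfun) \<Rightarrow> bool" where
  "OMp_morphism r r' P \<longleftrightarrow> even_operator P \<and> group_equivariant r r' P \<and>
     (\<forall>y. \<forall>F\<in>superfunctions. odd_act r' y (P F) \<doteq> P (odd_act r y F)) \<and>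
     (\<forall>y y'. \<forall>F\<in>superfunctions. bracket_act r' y y' (P F) \<doteq> P (bracket_act r y y' F))"

definition DD :: "superfun \<Rightarrow> superfun" where
  "DD F = (\<lambda>v. Dop 1 (Dop 2 F) v - Dop 2 (Dop 1 F) v)"

end

theory Submission
  imports Defs "HOL-Complex_Analysis.Cauchy_Integral_Formula"
begin

text \<open>
  On components F = a + b xi_1 + c xi_2 + d xi_1 xi_2 the operator is
  DD F = 2 (- d, d_12 b - d_11 c, d_22 b - d_12 c, (d_11 d_22 - d_12^2) a). The soul of the transformed
  coordinate vanishes: the action of (s, g, phi) is the pullback along Z = (A v + B) (C v + D)^-1,
  followed by multiplication of a, (b, c), d by phi^(-2r) times 1, s M, det M, where
  M = (C v + D)^-1. With the symmetric matrix S = M C one has, along a symmetric direction w,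
  dM = - S w M, dS = - S w S, dZ = M^T w M and d(1/phi) = - tr(S w) / (2 phi), and equivariance
  becomes a polynomial identity. The odd generators are handled by the same kind of expansion.

  Holomorphic functions on the Siegel space are packed into a commutative ring with commuting
  derivations, so that all of this is ring algebra. That partial derivatives are
  again holomorphic and commute follows by differentiating the one-variable Cauchy formula under
  the integral sign.
\<close>

section \<open>Derivatives on the Siegel space\<close>

text \<open>Symmetric matrices form a proper subspace, so \<open>siegel\<close> is not open among
  all matrices, and holomorphy is bare differentiability within it. Derivatives are therefore tested
  along symmetric lines, and continuity of the first partial derivatives has to be established
  before a second differentiation is possible. The weights come from two effects. Because phi^2 =
  det(C v + D), the top component d carries phi^(-2r) det M = phi^(-2r-2), the factor of a body in
  weight r + 1; since \<open>DD\<close> moves d into the body, r' = r + 1. The terms containing S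
  that arise from differentiating phi^(-2r) and M cancel only for r = 1/2. The minus sign of
  skew-invariance disappears under parity because odd generators exchange even and odd components.
  Operators see only values on \<open>siegel\<close>, so identities are stated up to
  \<open>\<doteq>\<close>; each operation is shown to respect this relation, which lets an arbitrary
  superfunction be replaced by some \<open>sf a b c d\<close>.\<close>

lemma transpose_eq_iff_2: "transpose (v::'a^2^2) = v \<longleftrightarrow> v$2$1 = v$1$2"
  by (auto simp: vec_eq_iff transpose_def forall_2)

text \<open>Sylvester's criterion for the imaginary part, read off the upper triangle. Unlike
  \<open>siegel\<close> this set is open in the space of all matrices, and \<open>siegel\<close> is
  its symmetric part.\<close>

definition im_pos :: "(complex^2^2) set" where
  "im_pos = {v. 0 < Im (v$1$1) \<and> (Im (v$1$2))\<^sup>2 < Im (v$1$1) * Im (v$2$2)}"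

lemma quadratic_form_2:
  fixes m :: "real^2^2"
  shows "x \<bullet> (m *v x) = m$1$1 * (x$1)\<^sup>2 + (m$1$2 + m$2$1) * x$1 * x$2 + m$2$2 * (x$2)\<^sup>2"
  by (simp add: inner_vec_def matrix_vector_mult_def sum_2 power2_eq_square algebra_simps)

lemma siegel_eq: "siegel = {v. transpose v = v} \<inter> im_pos"
proof (intro equalityI subsetI)
  fix v assume v: "v \<in> siegel"
  then have s: "v$2$1 = v$1$2" and p: "\<And>x::real^2. x \<noteq> 0 \<Longrightarrow> 0 < x \<bullet> (map_matrix Im v *v x)"
    by (auto simp: siegel_def transpose_eq_iff_2)
  have "0 < Im (v$1$1)"
    using p[of "vector [1, 0]"] by (simp add: quadratic_form_2 map_matrix_def vec_eq_iff forall_2)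
  \<comment> \<open>At the vector (- Im v_12, Im v_11) the quadratic form equals Im v_11 times the
    determinant of the imaginary part.\<close>
  moreover from this have "0 < Im (v$1$1) * (Im (v$1$1) * Im (v$2$2) - (Im (v$1$2))\<^sup>2)"
    using p[of "vector [- Im (v$1$2), Im (v$1$1)]"] s
    by (simp add: quadratic_form_2 map_matrix_def vec_eq_iff forall_2 power2_eq_square algebra_simps)
  ultimately show "v \<in> {v. transpose v = v} \<inter> im_pos"
    using v by (simp add: im_pos_def siegel_def zero_less_mult_iff)
next
  fix v assume "v \<in> {v. transpose v = v} \<inter> im_pos"
  then have s: "transpose v = v" "v$2$1 = v$1$2" and p: "0 < Im (v$1$1)" "(Im (v$1$2))\<^sup>2 < Im (v$1$1) * Im (v$2$2)"
    by (auto simp: transpose_eq_iff_2 im_pos_def)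
  have "0 < x \<bullet> (map_matrix Im v *v x)" if x: "x \<noteq> 0" for x :: "real^2"
  proof -
    define q where "q = x \<bullet> (map_matrix Im v *v x)"
    \<comment> \<open>Completing the square after multiplication by the positive entry Im
      v_11.\<close>
    have "Im (v$1$1) * q = (Im (v$1$1) * x$1 + Im (v$1$2) * x$2)\<^sup>2
        + (Im (v$1$1) * Im (v$2$2) - (Im (v$1$2))\<^sup>2) * (x$2)\<^sup>2"
      by (simp add: q_def quadratic_form_2 map_matrix_def s power2_eq_square algebra_simps)
    also have "\<dots> > 0"
    proof (cases "x$2 = 0")
      case True
      then have "x$1 \<noteq> 0" using x by (auto simp: vec_eq_iff forall_2)
      then show ?thesis using True p by simp
    next
      case False
      then show ?thesis using p by (intro add_nonneg_pos) auto
    qed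
    finally show ?thesis using p by (simp add: q_def zero_less_mult_iff)
  qed
  then show "v \<in> siegel" using s by (simp add: siegel_def)
qed

lemma open_im_pos: "open im_pos"
  unfolding im_pos_def by (intro open_Collect_conj open_Collect_less continuous_intros)

lemma siegel_symmetric: "v \<in> siegel \<Longrightarrow> transpose v = v"
  by (simp add: siegel_def)

lemma siegel_entry: "v \<in> siegel \<Longrightarrow> v$2$1 = v$1$2"
  by (simp add: siegel_def transpose_eq_iff_2)

text \<open>Needed because \<open>leibniz_rule\<close>, used for differentiation under the integral
  sign, asks for a convex set of parameters.\<close>

lemma convex_siegel: "convex siegel"
proof (rule convexI)
  fix v w :: "complex^2^2" and s t :: real
  assume v: "v \<in> siegel" and w: "w \<in> siegel" and st: "0 \<le> s" "0 \<le> t" "s + t = 1"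
  have "0 < x \<bullet> (map_matrix Im (s *\<^sub>R v + t *\<^sub>R w) *v x)" if x: "x \<noteq> 0" for x :: "real^2"
  proof -
    have "x \<bullet> (map_matrix Im (s *\<^sub>R v + t *\<^sub>R w) *v x) =
        s * (x \<bullet> (map_matrix Im v *v x)) + t * (x \<bullet> (map_matrix Im w *v x))"
      by (simp add: quadratic_form_2 map_matrix_def algebra_simps)
    moreover have "0 < x \<bullet> (map_matrix Im v *v x)" "0 < x \<bullet> (map_matrix Im w *v x)"
      using v w x by (auto simp: siegel_def)
    ultimately show ?thesis using st
      by (cases "s = 0") (auto intro!: add_pos_nonneg)
  qed
  then show "s *\<^sub>R v + t *\<^sub>R w \<in> siegel"
    using v w by (simp add: siegel_def transpose_eq_iff_2)
qed

text \<open>Parametrizes complex linear forms by coefficient matrices. As a bounded bilinear map it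
  supplies \<open>pairing.prod_right\<close>, through which an integral of derivatives becomes the
  pairing with an integrated coefficient matrix.\<close>

definition pairing :: "complex^2^2 \<Rightarrow> complex^2^2 \<Rightarrow> complex" where
  "pairing a w = (\<Sum>i\<in>UNIV. \<Sum>j\<in>UNIV. a$i$j * w$i$j)"

interpretation pairing: bounded_bilinear pairing
proof (rule bounded_bilinear.intro)
  have *: "norm (a $ i $ j) \<le> norm a" for a :: "complex^2^2" and i j
    by (rule order.trans[OF Finite_Cartesian_Product.norm_nth_le Finite_Cartesian_Product.norm_nth_le])
  have "norm (pairing a w) \<le> norm a * norm w * 4" for a w
  proof -
    have "norm (pairing a w) \<le> (\<Sum>i\<in>UNIV. \<Sum>j\<in>UNIV. norm (a$i$j * w$i$j))"
      unfolding pairing_def by (intro order.trans[OF norm_sum] sum_mono order.refl)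
    also have "\<dots> \<le> (\<Sum>i\<in>(UNIV::2 set). \<Sum>j\<in>(UNIV::2 set). norm a * norm w)"
      unfolding norm_mult by (intro sum_mono mult_mono * norm_ge_zero)
    finally show ?thesis by simp
  qed
  then show "\<exists>K. \<forall>a b. norm (pairing a b) \<le> norm a * norm b * K" by blast
qed (simp_all add: pairing_def sum_2 algebra_simps)

lemma smat_nth [simp]: "smat z w $ i $ j = z * w $ i $ j"
  by (simp add: smat_def map_matrix_def)

lemma bounded_linear_smat: "bounded_linear (\<lambda>z. smat z w)"
proof (rule linear_conv_bounded_linear[THEN iffD1])
  show "linear (\<lambda>z. smat z w)"
    by (rule linearI) (simp_all add: vec_eq_iff algebra_simps)
qed

lemma pairing_smat_left: "pairing (smat z a) w = z * pairing a w"
  and pairing_smat_right: "pairing a (smat z w) = z * pairing a w"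
  by (simp_all add: pairing_def sum_distrib_left mult_ac)

lemma holomorphic_siegel_iff:
  "holomorphic_siegel f \<longleftrightarrow> (\<forall>v\<in>siegel. \<exists>a. (f has_derivative pairing a) (at v within siegel))"
  by (simp add: holomorphic_siegel_def pairing_def[abs_def])

text \<open>For symmetric v and w only the open condition \<open>im_pos\<close> restricts z.\<close>

lemma open_siegel_line:
  assumes "v \<in> siegel" "transpose w = w"
  shows "open {z. v + smat z w \<in> siegel}"
proof -
  have "{z. v + smat z w \<in> siegel} = (\<lambda>z. v + smat z w) -` im_pos"
    using assms by (auto simp: siegel_eq transpose_eq_iff_2)
  moreover have "open \<dots>"
    by (intro open_vimage open_im_pos continuous_on_add continuous_on_const
        linear_continuous_on bounded_linear_smat)
  ultimately show ?thesis by simp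
qed

text \<open>On a symmetric line the parameter set is open, so a derivative within
  \<open>siegel\<close> turns into an ordinary complex derivative.\<close>

lemma has_field_derivative_line:
  assumes "v \<in> siegel" "transpose w = w" "v + smat z w \<in> siegel"
    and "(f has_derivative pairing a) (at (v + smat z w) within siegel)"
  shows "((\<lambda>z. f (v + smat z w)) has_field_derivative pairing a w) (at z)"
proof -
  let ?S = "{z. v + smat z w \<in> siegel}"
  have "((\<lambda>z. f (v + smat z w)) has_derivative (\<lambda>h. pairing a (smat h w))) (at z within ?S)"
  proof (rule has_derivative_in_compose[where f' = "\<lambda>h. smat h w" and g' = "pairing a"])
    show "((\<lambda>z. v + smat z w) has_derivative (\<lambda>h. smat h w)) (at z within ?S)"
      by (auto intro!: derivative_eq_intros bounded_linear.has_derivative[OF bounded_linear_smat])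
    show "(f has_derivative pairing a) (at (v + smat z w) within (\<lambda>z. v + smat z w) ` ?S)"
      using assms(4) by (rule has_derivative_subset) auto
  qed
  moreover have "at z within ?S = at z"
    using assms(3) by (intro at_within_open open_siegel_line assms) auto
  moreover have "(\<lambda>h. pairing a (smat h w)) = (*) (pairing a w)"
    by (simp add: fun_eq_iff pairing_smat_right mult.commute)
  ultimately show ?thesis
    by (simp only: has_field_derivative_def)
qed

lemma smat_0 [simp]: "smat 0 w = 0"
  by (simp add: vec_eq_iff)

lemma coord_dir_nth [simp]:
  "coord_dir i j $ k $ l = (if (k = i \<and> l = j) \<or> (k = j \<and> l = i) then 1 else 0)"
  by (simp add: coord_dir_def)

lemma coord_dir_symmetric: "transpose (coord_dir i j) = coord_dir i j"
  by (auto simp: transpose_eq_iff_2)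

text \<open>Only the symmetric part of a is visible on symmetric directions; the factor 1/2 in
  \<open>pd\<close> for i \<noteq> j makes the answer uniform in i and j.\<close>

lemma pd_eqI:
  assumes "v \<in> siegel" "(f has_derivative pairing a) (at v within siegel)"
  shows "pd i j f v = (a$i$j + a$j$i) / 2"
proof -
  have "deriv (\<lambda>z. f (v + smat z (coord_dir i j))) 0 = pairing a (coord_dir i j)"
    using has_field_derivative_line[OF assms(1) coord_dir_symmetric, of 0] assms
    by (intro DERIV_imp_deriv) simp
  then show ?thesis
    using exhaust_2[of i] exhaust_2[of j]
    by (elim disjE) (simp_all add: pd_def pairing_def sum_2)
qed

definition gradient :: "(complex^2^2 \<Rightarrow> complex) \<Rightarrow> complex^2^2 \<Rightarrow> complex^2^2" where
  "gradient f v = (\<chi> i j. pd i j f v)"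

lemma gradient_nth [simp]: "gradient f v $ i $ j = pd i j f v"
  by (simp add: gradient_def)

text \<open>A derivative within \<^const>\<open>siegel\<close> is only determined on symmetric matrices, so
  its coefficient matrix may be symmetrized.\<close>

lemma has_derivative_gradient:
  assumes "holomorphic_siegel f" "v \<in> siegel"
  shows "(f has_derivative pairing (gradient f v)) (at v within siegel)"
proof -
  obtain a where a: "(f has_derivative pairing a) (at v within siegel)"
    using assms by (auto simp: holomorphic_siegel_iff)
  have pd: "pd i j f v = (a$i$j + a$j$i) / 2" for i j
    using pd_eqI[OF assms(2) a] .
  have "pairing (gradient f v) (w - v) = pairing a (w - v)" if "w \<in> siegel" for w
    using siegel_entry[OF that] siegel_entry[OF assms(2)]
    by (simp add: pairing_def sum_2 pd field_simps)
  then have "((\<lambda>w. (1 / norm (w - v)) *\<^sub>R (f w - (f v + pairing (gradient f v) (w - v)))) \<longlongrightarrow> 0)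
        (at v within siegel)"
    using a unfolding has_derivative_within
    by (subst Lim_cong_within[where g = "\<lambda>w. (1 / norm (w - v)) *\<^sub>R (f w - (f v + pairing a (w - v)))"]) auto
  then show ?thesis
    unfolding has_derivative_within using pairing.bounded_linear_right by blast
qed

lemma holomorphic_siegelI:
  "(\<And>v. v \<in> siegel \<Longrightarrow> (f has_derivative pairing (a v)) (at v within siegel)) \<Longrightarrow> holomorphic_siegel f"
  by (auto simp: holomorphic_siegel_iff)

lemma holomorphic_siegel_cong:
  assumes "\<And>v. v \<in> siegel \<Longrightarrow> f v = g v"
  shows "holomorphic_siegel f \<longleftrightarrow> holomorphic_siegel g"
proof -
  have "holomorphic_siegel h" if "holomorphic_siegel k" "\<And>v. v \<in> siegel \<Longrightarrow> h v = k v" for h k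
    using that by (intro holomorphic_siegelI) (rule has_derivative_transform, assumption,
        auto intro: has_derivative_gradient)
  then show ?thesis using assms by metis
qed

text \<open>A small disc around 0 on the symmetric line stays in \<open>siegel\<close>, so values
  elsewhere do not affect \<open>deriv\<close>.\<close>

lemma pd_cong:
  assumes "v \<in> siegel" "\<And>v. v \<in> siegel \<Longrightarrow> f v = g v"
  shows "pd i j f v = pd i j g v"
proof -
  have "eventually (\<lambda>z. v + smat z (coord_dir i j) \<in> siegel) (nhds 0)"
    using open_siegel_line[OF assms(1) coord_dir_symmetric, of i j] assms(1)
    by (auto simp: eventually_nhds)
  then have "deriv (\<lambda>z. f (v + smat z (coord_dir i j))) 0 = deriv (\<lambda>z. g (v + smat z (coord_dir i j))) 0"
    by (intro deriv_cong_ev) (auto elim!: eventually_mono intro: assms(2))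
  then show ?thesis by (simp add: pd_def)
qed

lemma pd_commute: "pd j i f v = pd i j f v"
proof -
  have "coord_dir j i = coord_dir i j" by (auto simp: vec_eq_iff)
  then show ?thesis by (simp add: pd_def eq_commute)
qed

lemma holomorphic_siegel_has_derivative:
  assumes "\<And>v. v \<in> siegel \<Longrightarrow> (f has_derivative pairing (a v)) (at v within siegel)"
  shows "holomorphic_siegel f" and "v \<in> siegel \<Longrightarrow> pd i j f v = (a v$i$j + a v$j$i) / 2"
  using assms holomorphic_siegelI pd_eqI by blast+

context
  fixes f g assumes f: "holomorphic_siegel f" and g: "holomorphic_siegel g"
begin

lemma has_derivative_gradient_add:
  "v \<in> siegel \<Longrightarrow>
    ((\<lambda>v. f v + g v) has_derivative pairing (gradient f v + gradient g v)) (at v within siegel)"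
  by (rule derivative_eq_intros has_derivative_gradient f g | assumption)+
     (simp add: pairing.add_left fun_eq_iff)

lemma has_derivative_gradient_mult:
  "v \<in> siegel \<Longrightarrow>
    ((\<lambda>v. f v * g v) has_derivative pairing (smat (g v) (gradient f v) + smat (f v) (gradient g v)))
      (at v within siegel)"
  by (rule derivative_eq_intros has_derivative_gradient f g | assumption)+
     (simp add: pairing_smat_left pairing.add_left fun_eq_iff mult.commute)

lemma holomorphic_siegel_add: "holomorphic_siegel (\<lambda>v. f v + g v)"
  and pd_add: "v \<in> siegel \<Longrightarrow> pd i j (\<lambda>v. f v + g v) v = pd i j f v + pd i j g v"
  using holomorphic_siegel_has_derivative[OF has_derivative_gradient_add]
  by (simp_all add: pd_commute[of j i] pd_commute[of j i f] pd_commute[of j i g] add_divide_distrib)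

lemma holomorphic_siegel_mult: "holomorphic_siegel (\<lambda>v. f v * g v)"
  and pd_mult: "v \<in> siegel \<Longrightarrow> pd i j (\<lambda>v. f v * g v) v = g v * pd i j f v + f v * pd i j g v"
  using holomorphic_siegel_has_derivative[OF has_derivative_gradient_mult]
  by (simp_all add: pd_commute[of j i f] pd_commute[of j i g] add_divide_distrib)

end

lemma has_derivative_pairing_const: "((\<lambda>v. k) has_derivative pairing 0) (at v within siegel)"
proof -
  have "pairing 0 = (\<lambda>w. 0)" by (simp add: fun_eq_iff pairing.zero_left)
  then show ?thesis by simp
qed

lemma holomorphic_siegel_const: "holomorphic_siegel (\<lambda>v. k)"
  and pd_const: "v \<in> siegel \<Longrightarrow> pd i j (\<lambda>v. k) v = 0"
  using holomorphic_siegel_has_derivative[OF has_derivative_pairing_const] by simp_all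

lemma has_derivative_pairing_entry:
  "((\<lambda>v. v$k$l) has_derivative pairing (\<chi> i j. if i = k \<and> j = l then 1 else 0)) (at v within siegel)"
proof -
  have "bounded_linear (\<lambda>v::complex^2^2. v$k$l)"
    using bounded_linear_compose[OF bounded_linear_vec_nth[of l] bounded_linear_vec_nth[of k]] by simp
  moreover have "pairing (\<chi> i j. if i = k \<and> j = l then 1 else 0) = (\<lambda>v. v$k$l)"
    using exhaust_2[of k] exhaust_2[of l]
    by (elim disjE) (simp_all add: fun_eq_iff pairing_def sum_2)
  ultimately show ?thesis
    using bounded_linear_imp_has_derivative by metis
qed

lemma holomorphic_siegel_entry: "holomorphic_siegel (\<lambda>v. v$k$l)"
  and pd_entry: "v \<in> siegel \<Longrightarrow> pd i j (\<lambda>v. v$k$l) v =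
    ((if i = k \<and> j = l then 1 else 0) + (if j = k \<and> i = l then 1 else 0)) / 2"
  using holomorphic_siegel_has_derivative[OF has_derivative_pairing_entry] by simp_all

lemma holomorphic_siegel_inverse:
  assumes f: "holomorphic_siegel f" and nz: "\<And>v. v \<in> siegel \<Longrightarrow> f v \<noteq> 0"
  shows "holomorphic_siegel (\<lambda>v. inverse (f v))"
proof (rule holomorphic_siegelI)
  fix v assume v: "v \<in> siegel"
  show "((\<lambda>v. inverse (f v)) has_derivative pairing (smat (- (inverse (f v) * inverse (f v))) (gradient f v)))
      (at v within siegel)"
    by (rule derivative_eq_intros has_derivative_gradient f nz v)+
       (simp add: pairing_smat_left fun_eq_iff mult_ac)
qed

lemma continuous_on_holomorphic_siegel: "holomorphic_siegel f \<Longrightarrow> continuous_on siegel f"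
  by (meson continuous_on_eq_continuous_within has_derivative_continuous has_derivative_gradient)

lemma holomorphic_siegel_compose:
  assumes f: "holomorphic_siegel f" and Z: "\<And>v. v \<in> siegel \<Longrightarrow> Z v \<in> siegel"
    and hZ: "\<And>p q. holomorphic_siegel (\<lambda>v. Z v$p$q)"
  shows "holomorphic_siegel (\<lambda>v. f (Z v))"
    and "v \<in> siegel \<Longrightarrow> pd i j (\<lambda>v. f (Z v)) v =
      (\<Sum>p\<in>UNIV. \<Sum>q\<in>UNIV. pd p q f (Z v) * pd i j (\<lambda>v. Z v$p$q) v)"
proof -
  define a where "a = (\<lambda>v. \<chi> i j. \<Sum>p\<in>UNIV. \<Sum>q\<in>UNIV. pd p q f (Z v) * pd i j (\<lambda>v. Z v$p$q) v)"
  have "((\<lambda>v. f (Z v)) has_derivative pairing (a v)) (at v within siegel)" if v: "v \<in> siegel" for v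
  proof -
    have *: "(Z has_derivative (\<lambda>w. \<chi> p q. pairing (gradient (\<lambda>v. Z v$p$q) v) w)) (at v within siegel)"
    proof -
      \<comment> \<open>Elementary matrices reduce the derivative of the matrix-valued
        \<open>Z\<close> to those of its entries.\<close>
      define E where "E = (\<lambda>p q. (\<chi> i j. if i = p \<and> j = q then 1 else 0) :: complex^2^2)"
      have expand: "(\<chi> p q. a p q) = (\<Sum>p\<in>UNIV. \<Sum>q\<in>UNIV. smat (a p q) (E p q))" for a
        by (simp add: vec_eq_iff forall_2 sum_2 E_def)
      have "(\<lambda>v. \<Sum>p\<in>UNIV. \<Sum>q\<in>UNIV. smat (Z v$p$q) (E p q)) = Z"
        by (rule ext) (simp add: vec_eq_iff forall_2 sum_2 E_def)
      moreover have "((\<lambda>v. \<Sum>p\<in>UNIV. \<Sum>q\<in>UNIV. smat (Z v$p$q) (E p q)) has_derivative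
          (\<lambda>w. \<Sum>p\<in>UNIV. \<Sum>q\<in>UNIV. smat (pairing (gradient (\<lambda>v. Z v$p$q) v) w) (E p q)))
          (at v within siegel)"
        by (intro has_derivative_sum bounded_linear.has_derivative[OF bounded_linear_smat]
            has_derivative_gradient hZ v)
      ultimately show ?thesis unfolding expand by simp
    qed
    have "((\<lambda>v. f (Z v)) has_derivative
        (\<lambda>w. pairing (gradient f (Z v)) (\<chi> p q. pairing (gradient (\<lambda>v. Z v$p$q) v) w))) (at v within siegel)"
      by (rule has_derivative_in_compose2[where t = siegel and g' = "\<lambda>v. pairing (gradient f v)",
            OF has_derivative_gradient[OF f] _ v *]) (use Z in auto)
    moreover have "(\<lambda>w. pairing (gradient f (Z v)) (\<chi> p q. pairing (gradient (\<lambda>v. Z v$p$q) v) w)) = pairing (a v)"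
      by (simp add: fun_eq_iff pairing_def sum_2 a_def algebra_simps)
    ultimately show ?thesis by simp
  qed
  note * = holomorphic_siegel_has_derivative[OF this]
  show "holomorphic_siegel (\<lambda>v. f (Z v))" by (rule *(1))
  show "v \<in> siegel \<Longrightarrow> pd i j (\<lambda>v. f (Z v)) v =
      (\<Sum>p\<in>UNIV. \<Sum>q\<in>UNIV. pd p q f (Z v) * pd i j (\<lambda>v. Z v$p$q) v)"
    by (subst *(2)) (simp_all add: a_def pd_commute[of j i "\<lambda>v. Z v $ p $ q" for p q])
qed

section \<open>Cauchy's formula and the regularity of partial derivatives\<close>

lemma deriv_circle_integral:
  assumes g: "g holomorphic_on ball 0 R" and r: "0 < r" "r < R"
  shows "deriv g 0 = integral (cbox 0 1) (\<lambda>t. g (circlepath 0 r t) / circlepath 0 r t)"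
proof -
  have "g holomorphic_on cball 0 r"
    using g r by (auto intro: holomorphic_on_subset)
  then have "contour_integral (circlepath 0 r) (\<lambda>u. g u / (u - 0)\<^sup>2) = 2 * pi * \<i> * deriv g 0"
    using r by (intro Cauchy_contour_integral_circlepath_2 holomorphic_on_imp_continuous_on)
      (auto intro: holomorphic_on_subset)
  \<comment> \<open>The velocity of \<open>circlepath 0 r\<close> is 2 pi i times the point itself,
    which cancels one factor of u^2.\<close>
  moreover have "contour_integral (circlepath 0 r) (\<lambda>u. g u / (u - 0)\<^sup>2) =
      integral {0..1} (\<lambda>t. (2 * pi * \<i>) * (g (circlepath 0 r t) / circlepath 0 r t))"
    unfolding contour_integral_integral vector_derivative_circlepath
    using r by (intro integral_cong) (simp add: circlepath power2_eq_square field_simps)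
  ultimately show ?thesis
    unfolding integral_mult_right by simp
qed

text \<open>The radius R is uniform for base points near \<open>v0\<close>; a circle that does not
  move with v is what permits differentiation under the integral.\<close>

lemma siegel_line_radius:
  assumes v0: "v0 \<in> siegel" and w: "transpose w = w"
  obtains e R where "0 < e" "0 < R"
    "\<And>v z. v \<in> siegel \<inter> ball v0 e \<Longrightarrow> z \<in> ball 0 R \<Longrightarrow> v + smat z w \<in> siegel"
proof -
  have "open ((\<lambda>x. fst x + smat (snd x) w) -` im_pos)"
    by (intro open_vimage open_im_pos continuous_on_add continuous_on_fst continuous_on_id
        bounded_linear.continuous_on[OF bounded_linear_smat] continuous_on_snd)
  moreover have "(v0, 0) \<in> (\<lambda>x. fst x + smat (snd x) w) -` im_pos"
    using v0 by (simp add: siegel_eq)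
  ultimately obtain A B where AB: "open A" "open B" "v0 \<in> A" "0 \<in> B"
    "A \<times> B \<subseteq> (\<lambda>x. fst x + smat (snd x) w) -` im_pos"
    by (rule open_prod_elim) auto
  obtain e R where "0 < e" "ball v0 e \<subseteq> A" "0 < R" "ball 0 R \<subseteq> B"
    using AB(1-4) by (meson open_contains_ball)
  show ?thesis
  proof (rule that[OF \<open>0 < e\<close> \<open>0 < R\<close>])
    fix v z assume v: "v \<in> siegel \<inter> ball v0 e" and z: "z \<in> ball (0::complex) R"
    then have "(v, z) \<in> A \<times> B"
      using \<open>ball v0 e \<subseteq> A\<close> \<open>ball 0 R \<subseteq> B\<close> by blast
    then have "v + smat z w \<in> im_pos" using AB(5) by auto
    then show "v + smat z w \<in> siegel"
      using v w by (auto simp: siegel_eq transpose_eq_iff_2)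
  qed
qed

definition dirder :: "complex^2^2 \<Rightarrow> (complex^2^2 \<Rightarrow> complex) \<Rightarrow> complex^2^2 \<Rightarrow> complex" where
  "dirder w f v = deriv (\<lambda>z. f (v + smat z w)) 0"

lemma pd_dirder: "pd i j f = (\<lambda>v. (if i = j then 1 else 1/2) * dirder (coord_dir i j) f v)"
  by (simp add: fun_eq_iff pd_def dirder_def)

lemma dirder_integral:
  assumes f: "holomorphic_siegel f" and w: "transpose w = w" and v: "v \<in> siegel"
    and R: "\<And>z. z \<in> ball 0 R \<Longrightarrow> v + smat z w \<in> siegel" and r: "0 < r" "r < R"
  shows "dirder w f v = integral (cbox 0 1) (\<lambda>t. f (v + smat (circlepath 0 r t) w) / circlepath 0 r t)"
  unfolding dirder_def
proof (rule deriv_circle_integral[OF _ r])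
  show "(\<lambda>z. f (v + smat z w)) holomorphic_on ball 0 R"
    using has_field_derivative_line[OF v w R has_derivative_gradient[OF f R]]
    by (subst holomorphic_on_open) blast+
qed

text \<open>Neither e nor r depends on f: the same circle later represents both
  \<open>dirder w f\<close> and \<open>dirder w (pd i j f)\<close>.\<close>

lemma dirder_circle:
  assumes v0: "v0 \<in> siegel" and w: "transpose w = w"
  obtains e r where "0 < e" "0 < r"
    "\<And>v t. v \<in> siegel \<inter> ball v0 e \<Longrightarrow> v + smat (circlepath 0 r t) w \<in> siegel"
    "\<And>f v. holomorphic_siegel f \<Longrightarrow> v \<in> siegel \<inter> ball v0 e \<Longrightarrow>
      dirder w f v = integral (cbox 0 1) (\<lambda>t. f (v + smat (circlepath 0 r t) w) / circlepath 0 r t)"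
proof -
  obtain e R where e: "0 < e" "0 < R"
    and R: "\<And>v z. v \<in> siegel \<inter> ball v0 e \<Longrightarrow> z \<in> ball 0 R \<Longrightarrow> v + smat z w \<in> siegel"
    using siegel_line_radius[OF v0 w] by metis
  have "circlepath 0 (R / 2) t \<in> ball 0 R" for t
    using e by (simp add: circlepath norm_mult)
  then show ?thesis
    using e R by (intro that[of e "R / 2"] dirder_integral[OF _ w]) auto
qed

lemma continuous_on_circlepath_shift:
  fixes f :: "complex^2^2 \<Rightarrow> 'a::{banach, real_algebra_1}"
  assumes f: "continuous_on siegel f" and r: "r \<noteq> 0"
    and U: "\<And>v t. v \<in> U \<Longrightarrow> t \<in> cbox 0 1 \<Longrightarrow> v + smat (circlepath 0 r t) w \<in> siegel"
  shows "continuous_on (U \<times> cbox 0 1) (\<lambda>(v, t). f (v + smat (circlepath 0 r t) w))"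
  unfolding case_prod_beta circlepath
  by (rule continuous_on_compose2[OF f])
     (use U in \<open>auto simp: circlepath intro!: continuous_intros bounded_linear.continuous_on[OF bounded_linear_smat]\<close>)

text \<open>A circle integral of a continuous function depends continuously on v. This supplies the
  continuity of the derivative that \<open>leibniz_rule\<close> demands, which differentiability
  alone does not contain.\<close>

lemma continuous_on_dirder:
  assumes f: "holomorphic_siegel f" and w: "transpose w = w"
  shows "continuous_on siegel (dirder w f)"
  unfolding continuous_on_eq_continuous_within
proof
  fix v0 assume v0: "v0 \<in> siegel"
  obtain e r where e: "0 < e" and r: "0 < r"
    and line: "\<And>v t. v \<in> siegel \<inter> ball v0 e \<Longrightarrow> v + smat (circlepath 0 r t) w \<in> siegel"
    and circle: "\<And>f v. holomorphic_siegel f \<Longrightarrow> v \<in> siegel \<inter> ball v0 e \<Longrightarrow>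
      dirder w f v = integral (cbox 0 1) (\<lambda>t. f (v + smat (circlepath 0 r t) w) / circlepath 0 r t)"
    by (rule dirder_circle[OF v0 w]) blast
  define U where "U = siegel \<inter> ball v0 e"
  have "continuous_on (U \<times> cbox 0 1) (\<lambda>(v, t). f (v + smat (circlepath 0 r t) w) / circlepath 0 r t)"
    using continuous_on_circlepath_shift[OF continuous_on_holomorphic_siegel[OF f], of r U w] line r
    unfolding case_prod_beta U_def
    by (intro continuous_on_divide) (auto simp: circlepath intro!: continuous_intros)
  then have "continuous_on U (\<lambda>v. integral (cbox 0 1) (\<lambda>t. f (v + smat (circlepath 0 r t) w) / circlepath 0 r t))"
    by (rule integral_continuous_on_param)
  then have "continuous_on U (dirder w f)"
    by (rule continuous_on_eq) (simp add: circle[OF f] U_def)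
  then have "continuous (at v0 within U) (dirder w f)"
    using v0 e by (auto simp: continuous_on_eq_continuous_within U_def)
  moreover have "at v0 within U = at v0 within siegel"
    unfolding U_def using e by (intro at_within_nhd[of _ "ball v0 e"]) auto
  ultimately show "continuous (at v0 within siegel) (dirder w f)" by simp
qed

lemma continuous_on_pd: "holomorphic_siegel f \<Longrightarrow> continuous_on siegel (pd i j f)"
  unfolding pd_dirder by (intro continuous_on_mult_left continuous_on_dirder coord_dir_symmetric)

text \<open>Differentiating the circle integral in v replaces f by its gradient, so a_ij is the
  circle integral of \<open>pd i j f\<close>. Identifying it with
  \<open>dirder w (pd i j f) v0\<close> needs holomorphy of \<open>pd i j f\<close>, which is itself
  deduced from the first conclusion; hence the second one is conditional.\<close>

lemma has_derivative_dirder: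
  assumes f: "holomorphic_siegel f" and w: "transpose w = w" and v0: "v0 \<in> siegel"
  obtains a where "(dirder w f has_derivative pairing a) (at v0 within siegel)"
    "\<And>i j. holomorphic_siegel (pd i j f) \<Longrightarrow> a$i$j = dirder w (pd i j f) v0"
proof -
  obtain e r where e: "0 < e" and r: "0 < r"
    and line: "\<And>v t. v \<in> siegel \<inter> ball v0 e \<Longrightarrow> v + smat (circlepath 0 r t) w \<in> siegel"
    and circle: "\<And>f v. holomorphic_siegel f \<Longrightarrow> v \<in> siegel \<inter> ball v0 e \<Longrightarrow>
      dirder w f v = integral (cbox 0 1) (\<lambda>t. f (v + smat (circlepath 0 r t) w) / circlepath 0 r t)"
    by (rule dirder_circle[OF v0 w]) blast
  define U where "U = siegel \<inter> ball v0 e"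
  have v0U: "v0 \<in> U" using v0 e by (simp add: U_def)
  have lineU: "v + smat (circlepath 0 r t) w \<in> siegel" if "v \<in> U" for v t
    using line that by (simp add: U_def)
  have nz: "circlepath 0 r t \<noteq> 0" for t using r by (simp add: circlepath)
  \<comment> \<open>The gradient of the integrand; its integral over t will be the coefficient
    matrix.\<close>
  define h where "h = (\<lambda>v t. \<chi> i j. pd i j f (v + smat (circlepath 0 r t) w) / circlepath 0 r t)"
  have h_smat: "h v t = smat (inverse (circlepath 0 r t)) (gradient f (v + smat (circlepath 0 r t) w))" for v t
    by (simp add: h_def vec_eq_iff field_simps)
  have cont: "continuous_on (U \<times> cbox 0 1) (\<lambda>(v, t). g (v + smat (circlepath 0 r t) w) / circlepath 0 r t)"
    if "continuous_on siegel g" for g :: "complex^2^2 \<Rightarrow> complex"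
    using continuous_on_circlepath_shift[OF that, of r U w] lineU r
    unfolding case_prod_beta
    by (intro continuous_on_divide) (auto simp: circlepath intro!: continuous_intros)
  have cont_t: "continuous_on (cbox 0 1) (\<lambda>t. g (v + smat (circlepath 0 r t) w) / circlepath 0 r t)"
    if "continuous_on siegel g" "v \<in> U" for g :: "complex^2^2 \<Rightarrow> complex" and v
    using continuous_on_compose2[OF cont[OF that(1)], of "cbox 0 1" "Pair v"] that(2)
    by (auto simp: continuous_on_Pair)
  have cont_h: "continuous_on (U \<times> cbox 0 1) (\<lambda>(v, t). h v t)"
    using cont[OF continuous_on_pd[OF f]] unfolding h_def case_prod_beta
    by (intro continuous_on_vec_lambda)
  then have "continuous_on (cbox 0 1) (h v0)"
    using continuous_on_compose2[OF cont_h, of "cbox 0 1" "Pair v0"] v0U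
    by (auto simp: continuous_on_Pair)
  then have int_h: "h v0 integrable_on cbox 0 1"
    by (rule integrable_continuous)
  have deriv: "((\<lambda>v. f (v + smat (circlepath 0 r t) w) / circlepath 0 r t) has_derivative
      blinfun_apply (pairing.prod_right (h v t))) (at v within U)" if v: "v \<in> U" for v t
  proof -
    have "((\<lambda>v. f (v + smat (circlepath 0 r t) w)) has_derivative
        pairing (gradient f (v + smat (circlepath 0 r t) w))) (at v within U)"
      by (rule has_derivative_in_compose2[where t = siegel and f' = "\<lambda>h. h" and
            g' = "\<lambda>v. pairing (gradient f v)", OF has_derivative_gradient[OF f] _ v])
         (auto intro!: derivative_eq_intros lineU)
    then have "((\<lambda>v. inverse (circlepath 0 r t) * f (v + smat (circlepath 0 r t) w)) has_derivative
        (\<lambda>x. inverse (circlepath 0 r t) * pairing (gradient f (v + smat (circlepath 0 r t) w)) x)) (at v within U)"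
      by (rule has_derivative_mult_right)
    then show ?thesis
      by (simp add: h_smat pairing_smat_left[abs_def] field_simps)
  qed
  have "((\<lambda>v. integral (cbox 0 1) (\<lambda>t. f (v + smat (circlepath 0 r t) w) / circlepath 0 r t)) has_derivative
      blinfun_apply (integral (cbox 0 1) (\<lambda>t. pairing.prod_right (h v0 t)))) (at v0 within U)"
  proof (rule leibniz_rule[OF deriv _ _ v0U])
    show "convex U" unfolding U_def by (intro convex_Int convex_siegel convex_ball)
    show "(\<lambda>t. f (v + smat (circlepath 0 r t) w) / circlepath 0 r t) integrable_on cbox 0 1" if "v \<in> U" for v
      using cont_t[OF continuous_on_holomorphic_siegel[OF f] that] by (rule integrable_continuous)
    show "continuous_on (U \<times> cbox 0 1) (\<lambda>(v, t). pairing.prod_right (h v t))"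
      using bounded_linear.continuous_on[OF pairing.bounded_linear_prod_right cont_h]
      by (simp add: case_prod_beta)
  qed
  \<comment> \<open>Integration commutes with the bounded linear map
    \<open>pairing.prod_right\<close>, so the derivative is again the pairing with one
    matrix.\<close>
  moreover have "integral (cbox 0 1) (\<lambda>t. pairing.prod_right (h v0 t)) =
      pairing.prod_right (integral (cbox 0 1) (h v0))"
    using integral_linear[OF int_h pairing.bounded_linear_prod_right] by (simp add: o_def)
  ultimately have "((\<lambda>v. integral (cbox 0 1) (\<lambda>t. f (v + smat (circlepath 0 r t) w) / circlepath 0 r t))
      has_derivative pairing (integral (cbox 0 1) (h v0))) (at v0 within U)"
    by simp
  then have "(dirder w f has_derivative pairing (integral (cbox 0 1) (h v0))) (at v0 within U)"
    by (rule has_derivative_transform[OF v0U, rotated]) (simp add: circle[OF f] U_def)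
  moreover have "at v0 within U = at v0 within siegel"
    unfolding U_def using e by (intro at_within_nhd[of _ "ball v0 e"]) auto
  moreover have "integral (cbox 0 1) (h v0) $ i $ j = dirder w (pd i j f) v0"
    if g: "holomorphic_siegel (pd i j f)" for i j
  proof -
    have "bounded_linear (\<lambda>v::complex^2^2. v$i$j)"
      using bounded_linear_compose[OF bounded_linear_vec_nth[of j] bounded_linear_vec_nth[of i]] by simp
    from integral_linear[OF int_h this]
    have "integral (cbox 0 1) (h v0) $ i $ j = integral (cbox 0 1) (\<lambda>t. h v0 t $ i $ j)"
      by (simp add: o_def)
    also have "\<dots> = dirder w (pd i j f) v0"
      using circle[OF g, of v0] v0U by (simp add: h_def U_def)
    finally show ?thesis .
  qed
  ultimately show ?thesis
    by (intro that[of "integral (cbox 0 1) (h v0)"]) simp_all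
qed

lemma holomorphic_siegel_dirder:
  assumes "holomorphic_siegel f" "transpose w = w"
  shows "holomorphic_siegel (dirder w f)"
  unfolding holomorphic_siegel_iff using has_derivative_dirder[OF assms] by metis

lemma holomorphic_siegel_pd: "holomorphic_siegel f \<Longrightarrow> holomorphic_siegel (pd i j f)"
  unfolding pd_dirder
  by (intro holomorphic_siegel_mult holomorphic_siegel_const holomorphic_siegel_dirder coord_dir_symmetric)

text \<open>\<open>has_derivative_dirder\<close> gives the coefficients of the derivative of
  \<open>dirder w f\<close> as w-derivatives of \<open>pd i j f\<close>; taking w to be
  \<open>coord_dir k l\<close> exchanges the two.\<close>

lemma pd_pd_commute:
  assumes f: "holomorphic_siegel f" and v: "v \<in> siegel"
  shows "pd i j (pd k l f) v = pd k l (pd i j f) v"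
proof -
  define w c where "w = coord_dir k l" and "c = (if k = l then 1 else 1/2 :: complex)"
  have w: "transpose w = w" by (simp add: w_def coord_dir_symmetric)
  obtain a where a: "(dirder w f has_derivative pairing a) (at v within siegel)"
    "\<And>i j. a$i$j = dirder w (pd i j f) v"
    using has_derivative_dirder[OF f w v] holomorphic_siegel_pd[OF f] by metis
  have "pd i j (pd k l f) v = pd i j (\<lambda>v. c * dirder w f v) v"
    by (simp add: pd_dirder[of k l] w_def c_def)
  also have "\<dots> = c * pd i j (dirder w f) v"
    using pd_mult[OF holomorphic_siegel_const holomorphic_siegel_dirder[OF f w] v]
    by (simp add: pd_const v)
  also have "pd i j (dirder w f) v = dirder w (pd i j f) v"
    using pd_eqI[OF v a(1), of i j] a(2) ext[of "pd j i f" "pd i j f", OF pd_commute] by simp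
  finally show ?thesis by (simp add: pd_dirder[of k l] w_def c_def)
qed

section \<open>The ring of holomorphic functions\<close>

text \<open>Setting functions to 0 outside \<open>siegel\<close> turns agreement on
  \<open>siegel\<close> into equality of elements, so the type carries a genuine ring
  structure.\<close>

typedef holfun = "{f. holomorphic_siegel f \<and> (\<forall>v. v \<notin> siegel \<longrightarrow> f v = 0)}"
  morphisms ev Abs_holfun
  by (intro exI[of _ "\<lambda>v. 0"]) (simp add: holomorphic_siegel_const)

definition holfun :: "(complex^2^2 \<Rightarrow> complex) \<Rightarrow> holfun" where
  "holfun f = Abs_holfun (\<lambda>v. if v \<in> siegel then f v else 0)"

lemma holomorphic_ev: "holomorphic_siegel (ev x)"
  and ev_outside: "v \<notin> siegel \<Longrightarrow> ev x v = 0"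
  using ev[of x] by auto

lemma ev_holfun:
  assumes "holomorphic_siegel f"
  shows "ev (holfun f) v = (if v \<in> siegel then f v else 0)"
proof -
  have "holomorphic_siegel (\<lambda>v. if v \<in> siegel then f v else 0)"
    using assms by (subst holomorphic_siegel_cong[where g = f]) auto
  then show ?thesis by (simp add: holfun_def Abs_holfun_inverse)
qed

lemma holfun_eqI: "(\<And>v. v \<in> siegel \<Longrightarrow> ev x v = ev y v) \<Longrightarrow> x = y"
  using ev_outside by (intro ev_inject[THEN iffD1] ext) metis

text \<open>Scalars such as 1/2 and r enter this way, since \<open>holfun\<close> is a ring without
  division.\<close>

definition const :: "complex \<Rightarrow> holfun" where
  "const k = holfun (\<lambda>v. k)"

lemma ev_const: "ev (const k) v = (if v \<in> siegel then k else 0)"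
  by (simp add: const_def ev_holfun holomorphic_siegel_const)

text \<open>The point i times the identity witnesses 0 \<noteq> 1 in \<open>holfun\<close>.\<close>

lemma siegel_nonempty: "siegel \<noteq> {}"
proof -
  have "mat \<i> \<in> siegel"
    by (simp add: siegel_eq transpose_eq_iff_2 im_pos_def mat_def)
  then show ?thesis by blast
qed

instantiation holfun :: comm_ring_1
begin

definition "0 = const 0"
definition "1 = const 1"
definition "x + y = holfun (\<lambda>v. ev x v + ev y v)"
definition "x * y = holfun (\<lambda>v. ev x v * ev y v)"
definition "- x = const (- 1) * (x::holfun)"
definition "x - y = x + (- y :: holfun)"

lemma ev_add: "ev (x + y) v = ev x v + ev y v"
  and ev_mult: "ev (x * y) v = ev x v * ev y v"
  by (simp_all add: plus_holfun_def times_holfun_def ev_holfun holomorphic_siegel_add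
      holomorphic_siegel_mult holomorphic_ev ev_outside)

lemma ev_minus: "ev (- x) v = - ev x v"
  and ev_diff: "ev (x - y) v = ev x v - ev y v"
  and ev_0: "ev 0 v = 0"
  and ev_1: "v \<in> siegel \<Longrightarrow> ev 1 v = 1"
  by (simp_all add: uminus_holfun_def minus_holfun_def zero_holfun_def one_holfun_def
      ev_mult ev_add ev_const ev_outside)

instance
proof
  show "0 \<noteq> (1::holfun)"
    using siegel_nonempty ev_0 ev_1 by (metis all_not_in_conv zero_neq_one)
qed (auto intro!: holfun_eqI simp: ev_add ev_mult ev_minus ev_diff ev_0 ev_1 algebra_simps)

end

lemma ev_numeral: "v \<in> siegel \<Longrightarrow> ev (numeral n) v = numeral n"
proof (induction n)
  case (Bit0 n) then show ?case by (simp only: numeral_Bit0 ev_add)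
next
  case (Bit1 n) then show ?case by (simp only: numeral_Bit1 ev_add ev_1)
qed (simp add: ev_1)

lemma ev_power: "v \<in> siegel \<Longrightarrow> ev (x ^ n) v = ev x v ^ n"
  by (induction n) (simp_all add: ev_1 ev_mult)

lemmas ev_simps = ev_add ev_mult ev_minus ev_diff ev_0 ev_1 ev_numeral ev_power ev_const

definition coord :: "2 \<Rightarrow> 2 \<Rightarrow> holfun" where
  "coord k l = holfun (\<lambda>v. v$k$l)"

lemma ev_coord: "v \<in> siegel \<Longrightarrow> ev (coord k l) v = v$k$l"
  by (simp add: coord_def ev_holfun holomorphic_siegel_entry)

definition del :: "2 \<Rightarrow> 2 \<Rightarrow> holfun \<Rightarrow> holfun" where
  "del i j x = holfun (pd i j (ev x))"

lemma ev_del: "v \<in> siegel \<Longrightarrow> ev (del i j x) v = pd i j (ev x) v"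
  by (simp add: del_def ev_holfun holomorphic_siegel_pd holomorphic_ev)

lemma pd_ev_cong:
  assumes "v \<in> siegel" "\<And>v. v \<in> siegel \<Longrightarrow> ev x v = f v"
  shows "ev (del i j x) v = pd i j f v"
  using pd_cong[OF assms(1), of "ev x" f] assms by (simp add: ev_del)

lemma del_add: "del i j (x + y) = del i j x + del i j y"
proof (rule holfun_eqI)
  fix v assume v: "v \<in> siegel"
  have "ev (del i j (x + y)) v = pd i j (\<lambda>v. ev x v + ev y v) v"
    by (rule pd_ev_cong[OF v]) (simp add: ev_add)
  then show "ev (del i j (x + y)) v = ev (del i j x + del i j y) v"
    by (simp add: pd_add holomorphic_ev ev_add ev_del v)
qed

lemma del_mult: "del i j (x * y) = y * del i j x + x * del i j y"
proof (rule holfun_eqI)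
  fix v assume v: "v \<in> siegel"
  have "ev (del i j (x * y)) v = pd i j (\<lambda>v. ev x v * ev y v) v"
    by (rule pd_ev_cong[OF v]) (simp add: ev_mult)
  then show "ev (del i j (x * y)) v = ev (y * del i j x + x * del i j y) v"
    by (simp add: pd_mult holomorphic_ev ev_add ev_mult ev_del v)
qed

lemma del_const: "del i j (const k) = 0"
  by (rule holfun_eqI)
     (simp add: pd_ev_cong[where x = "const k" and f = "\<lambda>v. k"] pd_const ev_const ev_0)

lemma del_minus: "del i j (- x) = - del i j x"
  and del_diff: "del i j (x - y) = del i j x - del i j y"
  and del_0: "del i j 0 = 0"
  and del_1: "del i j 1 = 0"
proof -
  show "del i j 0 = 0" "del i j 1 = 0"
    by (simp_all only: zero_holfun_def one_holfun_def del_const)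
  then have "del i j (- x) = - del i j x" for x
    using del_add[of i j x "- x"] by (simp add: eq_neg_iff_add_eq_0 add.commute)
  then show "del i j (- x) = - del i j x" "del i j (x - y) = del i j x - del i j y"
    using del_add[of i j x "- y"] by simp_all
qed

lemma del_numeral: "del i j (numeral n) = 0"
proof (induction n)
  case (Bit0 n) then show ?case by (simp only: numeral_Bit0 del_add add_0_left)
next
  case (Bit1 n) then show ?case by (simp only: numeral_Bit1 del_add del_1 add_0_left)
qed (simp add: del_1)

lemma del_coord: "del i j (coord k l) =
    const (((if i = k \<and> j = l then 1 else 0) + (if j = k \<and> i = l then 1 else 0)) / 2)"
  by (rule holfun_eqI)
     (simp add: pd_ev_cong[where x = "coord k l" and f = "\<lambda>v. v$k$l"] ev_coord pd_entry ev_const)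

lemma del_sym: "del 2 1 x = del 1 2 x"
  by (simp add: del_def pd_commute[of 2 1, abs_def])

lemma del_del: "del i j (del k l x) = del k l (del i j x)"
proof (rule holfun_eqI)
  fix v assume v: "v \<in> siegel"
  show "ev (del i j (del k l x)) v = ev (del k l (del i j x)) v"
    using pd_ev_cong[OF v ev_del] pd_pd_commute[OF holomorphic_ev v] by simp
qed

lemma coord_sym: "coord 2 1 = coord 1 2"
  by (rule holfun_eqI) (simp add: ev_coord siegel_entry)

text \<open>The instances of \<open>del_del\<close> sort iterated derivatives, 11 outermost and 22
  innermost, so that simplification reaches a normal form.\<close>

lemmas del_simps = del_add del_mult del_const del_minus del_diff del_0 del_1 del_numeral del_coord
  del_sym coord_sym del_del[of 1 2 1 1] del_del[of 2 2 1 1] del_del[of 2 2 1 2]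

section \<open>Superfunctions and operators in components\<close>

definition sf :: "holfun \<Rightarrow> holfun \<Rightarrow> holfun \<Rightarrow> holfun \<Rightarrow> superfun" where
  "sf a b c d = (\<lambda>v. Grass (ev a v) (ev b v) (ev c v) (ev d v))"

lemma sf_in_superfunctions: "sf a b c d \<in> superfunctions"
  by (simp add: superfunctions_def sf_def o_def holomorphic_ev)

lemma eq_on_siegelI: "(\<And>v. v \<in> siegel \<Longrightarrow> F v = G v) \<Longrightarrow> F \<doteq> G"
  and eq_on_siegelD: "F \<doteq> G \<Longrightarrow> v \<in> siegel \<Longrightarrow> F v = G v"
  and eq_on_siegel_trans [trans]: "F \<doteq> G \<Longrightarrow> G \<doteq> H \<Longrightarrow> F \<doteq> H"
  by (simp_all add: eq_on_siegel_def)

lemma superfunction_sf: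
  assumes "F \<in> superfunctions"
  obtains a b c d where "F \<doteq> sf a b c d"
proof (rule that)
  show "F \<doteq> sf (holfun (c0 \<circ> F)) (holfun (c1 \<circ> F)) (holfun (c2 \<circ> F)) (holfun (c12 \<circ> F))"
    using assms by (intro eq_on_siegelI) (simp add: sf_def superfunctions_def ev_holfun)
qed

lemma superfunctions_cong:
  assumes "F \<doteq> G" "G \<in> superfunctions"
  shows "F \<in> superfunctions"
proof -
  have "holomorphic_siegel (c \<circ> F) \<longleftrightarrow> holomorphic_siegel (c \<circ> G)" for c
    using assms(1) by (intro holomorphic_siegel_cong) (simp add: eq_on_siegelD)
  then show ?thesis using assms(2) by (simp add: superfunctions_def)
qed

lemmas grass_simps = zero_grass_def one_grass_def plus_grass_def uminus_grass_def minus_grass_def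
  times_grass_def gconst_def

lemma dxi_cong: "F \<doteq> G \<Longrightarrow> dxi i F \<doteq> dxi i G"
  by (simp add: eq_on_siegel_def dxi_def)

lemma dv_cong: "F \<doteq> G \<Longrightarrow> dv i j F \<doteq> dv i j G"
  by (auto simp: eq_on_siegel_def dv_def intro!: pd_cong)

lemma Dop_cong: "F \<doteq> G \<Longrightarrow> Dop i F \<doteq> Dop i G"
  by (rule eq_on_siegelI) (simp add: Dop_def eq_on_siegelD[OF dxi_cong, of F G] eq_on_siegelD[OF dv_cong, of F G])

lemma Dq_cong: "F \<doteq> G \<Longrightarrow> Dq r i F \<doteq> Dq r i G"
  by (rule eq_on_siegelI) (simp add: Dq_def eq_on_siegelD[of F G] eq_on_siegelD[OF Dop_cong, of F G])

lemma odd_act_cong: "F \<doteq> G \<Longrightarrow> odd_act r y F \<doteq> odd_act r y G"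
  by (rule eq_on_siegelI)
     (simp add: odd_act_def case_prod_beta eq_on_siegelD[OF Dop_cong, of F G] eq_on_siegelD[OF Dq_cong, of F G])

lemma DD_cong: "F \<doteq> G \<Longrightarrow> DD F \<doteq> DD G"
  unfolding DD_def
  by (rule eq_on_siegelI) (intro arg_cong2[where f = "(-)"] eq_on_siegelD[OF Dop_cong[OF Dop_cong]])

lemma parity_cong: "F \<doteq> G \<Longrightarrow> parity F \<doteq> parity G"
  by (simp add: eq_on_siegel_def parity_def)

lemma parity_sf: "parity (sf a b c d) = sf a (- b) (- c) d"
  by (simp add: parity_def sf_def ev_simps)

lemma dv_sf: "dv i j (sf a b c d) \<doteq> sf (del i j a) (del i j b) (del i j c) (del i j d)"
  by (rule eq_on_siegelI) (simp add: dv_def sf_def o_def ev_del)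

lemma Dop_sf_1: "Dop 1 (sf a b c d) \<doteq>
    sf b (- del 1 1 a) (d - del 1 2 a) (del 1 2 b - del 1 1 c)"
  using dv_sf[of 1 1 a b c d] dv_sf[of 1 2 a b c d]
  by (simp add: eq_on_siegel_def Dop_def sum_2 dxi_def sf_def xi_def grass_simps ev_simps)

lemma Dop_sf_2: "Dop 2 (sf a b c d) \<doteq>
    sf c (- d - del 1 2 a) (- del 2 2 a) (del 2 2 b - del 1 2 c)"
  using dv_sf[of 2 1 a b c d] dv_sf[of 2 2 a b c d]
  by (simp add: eq_on_siegel_def Dop_def sum_2 dxi_def sf_def xi_def grass_simps ev_simps del_sym)

lemma DD_sf: "DD (sf a b c d) \<doteq> sf (- 2 * d) (2 * (del 1 2 b - del 1 1 c)) (2 * (del 2 2 b - del 1 2 c))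
    (2 * (del 1 1 (del 2 2 a) - del 1 2 (del 1 2 a)))"
proof -
  note 1 = eq_on_siegel_trans[OF Dop_cong[OF Dop_sf_2] Dop_sf_1]
    and 2 = eq_on_siegel_trans[OF Dop_cong[OF Dop_sf_1] Dop_sf_2]
  show ?thesis
    using 1[of a b c d] 2[of a b c d] by (simp add: eq_on_siegel_def DD_def)
      (simp add: sf_def grass_simps ev_simps del_simps)
qed

text \<open>In the top component, c/2 is the soul of T_21 times the body c of \<open>Dop 2\<close>,
  and - r c comes from - r xi_1 F.\<close>

lemma Dq_sf_1: "Dq r 1 (sf a b c d) \<doteq>
    sf (coord 1 1 * b + coord 1 2 * c)
       (- coord 1 1 * del 1 1 a - coord 1 2 * (d + del 1 2 a) - const (of_real r) * a)
       (coord 1 1 * (d - del 1 2 a) - coord 1 2 * del 2 2 a)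
       (coord 1 1 * (del 1 2 b - del 1 1 c) + coord 1 2 * (del 2 2 b - del 1 2 c)
         + const (1/2 - of_real r) * c)"
  using Dop_sf_1[of a b c d] Dop_sf_2[of a b c d]
  by (simp add: eq_on_siegel_def Dq_def sum_2)
     (simp add: sf_def xi_def Tmat_def grass_simps ev_simps ev_coord siegel_entry algebra_simps)

text \<open>The soul of T_12 has the opposite sign to that of T_21, and xi_2 xi_1 = - xi_1 xi_2;
  hence the minus in front of the last term.\<close>

lemma Dq_sf_2: "Dq r 2 (sf a b c d) \<doteq>
    sf (coord 1 2 * b + coord 2 2 * c)
       (- coord 1 2 * del 1 1 a - coord 2 2 * (d + del 1 2 a))
       (coord 1 2 * (d - del 1 2 a) - coord 2 2 * del 2 2 a - const (of_real r) * a)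
       (coord 1 2 * (del 1 2 b - del 1 1 c) + coord 2 2 * (del 2 2 b - del 1 2 c)
         - const (1/2 - of_real r) * b)"
  using Dop_sf_1[of a b c d] Dop_sf_2[of a b c d]
  by (simp add: eq_on_siegel_def Dq_def sum_2)
     (simp add: sf_def xi_def Tmat_def grass_simps ev_simps ev_coord siegel_entry algebra_simps)

section \<open>Parity and the odd generators\<close>

lemma sf_add: "(\<lambda>v. sf a b c d v + sf a' b' c' d' v) = sf (a + a') (b + b') (c + c') (d + d')"
  by (simp add: fun_eq_iff sf_def grass_simps ev_simps)

lemma sf_scale: "(\<lambda>v. gconst k * sf a b c d v) = sf (const k * a) (const k * b) (const k * c) (const k * d)"
  by (simp add: fun_eq_iff sf_def grass_simps ev_simps ev_outside)

lemma odd_act_sf: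
  "odd_act r (\<alpha>, \<beta>) (sf a b c d) \<doteq>
    sf (const (\<alpha>$1) * b + const (\<alpha>$2) * c
        + const (\<beta>$1) * (coord 1 1 * b + coord 1 2 * c) + const (\<beta>$2) * (coord 1 2 * b + coord 2 2 * c))
       (const (\<alpha>$1) * (- del 1 1 a) + const (\<alpha>$2) * (- d - del 1 2 a)
        + const (\<beta>$1) * (- coord 1 1 * del 1 1 a - coord 1 2 * (d + del 1 2 a) - const (of_real r) * a)
        + const (\<beta>$2) * (- coord 1 2 * del 1 1 a - coord 2 2 * (d + del 1 2 a)))
       (const (\<alpha>$1) * (d - del 1 2 a) + const (\<alpha>$2) * (- del 2 2 a)
        + const (\<beta>$1) * (coord 1 1 * (d - del 1 2 a) - coord 1 2 * del 2 2 a)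
        + const (\<beta>$2) * (coord 1 2 * (d - del 1 2 a) - coord 2 2 * del 2 2 a - const (of_real r) * a))
       (const (\<alpha>$1) * (del 1 2 b - del 1 1 c) + const (\<alpha>$2) * (del 2 2 b - del 1 2 c)
        + const (\<beta>$1) * (coord 1 1 * (del 1 2 b - del 1 1 c) + coord 1 2 * (del 2 2 b - del 1 2 c)
            + const (1/2 - of_real r) * c)
        + const (\<beta>$2) * (coord 1 2 * (del 1 2 b - del 1 1 c) + coord 2 2 * (del 2 2 b - del 1 2 c)
            - const (1/2 - of_real r) * b))"
  using Dop_sf_1[of a b c d] Dop_sf_2[of a b c d] Dq_sf_1[of r a b c d] Dq_sf_2[of r a b c d]
  by (simp add: eq_on_siegel_def odd_act_def sum_2)
     (simp add: sf_def grass_simps ev_simps)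

lemma odd_act_in_superfunctions:
  assumes "F \<in> superfunctions"
  shows "odd_act r y F \<in> superfunctions"
proof (cases y)
  case (Pair \<alpha> \<beta>)
  obtain a b c d where "F \<doteq> sf a b c d" using superfunction_sf[OF assms] .
  from superfunctions_cong[OF eq_on_siegel_trans[OF odd_act_cong[OF this] odd_act_sf] sf_in_superfunctions]
  show ?thesis by (simp add: Pair)
qed

text \<open>The generator q_1 already fixes both weights. In general the two bodies differ by a
  multiple of (1/2 - r) c, so r = 1/2. In the xi_1 component the derivatives of v_11 and v_12
  contribute 1 + 1/2 to the coefficient of d, which matches r' = 3/2.\<close>

lemma DD_odd_act_sf:
  "odd_act (3/2) (\<alpha>, \<beta>) (DD (sf a b c d)) \<doteq> (\<lambda>v. - DD (odd_act (1/2) (\<alpha>, \<beta>) (sf a b c d)) v)"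
proof (rule eq_on_siegelI)
  fix v assume v: "v \<in> siegel"
  show "odd_act (3/2) (\<alpha>, \<beta>) (DD (sf a b c d)) v = - DD (odd_act (1/2) (\<alpha>, \<beta>) (sf a b c d)) v"
    unfolding eq_on_siegelD[OF eq_on_siegel_trans[OF odd_act_cong[OF DD_sf] odd_act_sf] v]
      eq_on_siegelD[OF eq_on_siegel_trans[OF DD_cong[OF odd_act_sf] DD_sf] v]
    using v by (simp add: sf_def grass_simps del_simps ev_simps ev_coord)
      (simp add: field_simps)
qed

lemma DD_odd_act:
  assumes "F \<in> superfunctions"
  shows "odd_act (3/2) y (DD F) \<doteq> (\<lambda>v. - DD (odd_act (1/2) y F) v)"
proof (cases y)
  case (Pair \<alpha> \<beta>)
  obtain a b c d where F: "F \<doteq> sf a b c d" using superfunction_sf[OF assms] .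
  show ?thesis
    using DD_odd_act_sf[of \<alpha> \<beta> a b c d] eq_on_siegelD[OF odd_act_cong[OF DD_cong[OF F]]]
      eq_on_siegelD[OF DD_cong[OF odd_act_cong[OF F]]]
    by (simp add: eq_on_siegel_def Pair)
qed

section \<open>Even operators and the parity twist\<close>

lemma even_sf: "even_superfun (sf a b c d) \<longleftrightarrow> b = 0 \<and> c = 0"
  and odd_sf: "odd_superfun (sf a b c d) \<longleftrightarrow> a = 0 \<and> d = 0"
  by (auto simp: even_superfun_def odd_superfun_def even_grass_def odd_grass_def sf_def ev_0
      intro!: holfun_eqI)

lemma even_superfun_cong: "F \<doteq> G \<Longrightarrow> even_superfun F \<longleftrightarrow> even_superfun G"
  and odd_superfun_cong: "F \<doteq> G \<Longrightarrow> odd_superfun F \<longleftrightarrow> odd_superfun G"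
  by (simp_all add: even_superfun_def odd_superfun_def eq_on_siegel_def)

text \<open>Evenness is built into the shape of the formula: p0 and p12 see only a and d, p1 and p2
  only b and c. One criterion serves both \<open>DD\<close> and its composite with
  \<open>parity\<close>.\<close>

lemma even_operatorI:
  assumes cong: "\<And>F G. F \<doteq> G \<Longrightarrow> P F \<doteq> P G"
    and sf: "\<And>a b c d. P (sf a b c d) \<doteq> sf (p0 a d) (p1 b c) (p2 b c) (p12 a d)"
    and lin: "\<And>a b a' b'. p0 (a + a') (b + b') = p0 a b + p0 a' b'"
      "\<And>a b a' b'. p1 (a + a') (b + b') = p1 a b + p1 a' b'"
      "\<And>a b a' b'. p2 (a + a') (b + b') = p2 a b + p2 a' b'"
      "\<And>a b a' b'. p12 (a + a') (b + b') = p12 a b + p12 a' b'"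
      "\<And>k a b. p0 (const k * a) (const k * b) = const k * p0 a b"
      "\<And>k a b. p1 (const k * a) (const k * b) = const k * p1 a b"
      "\<And>k a b. p2 (const k * a) (const k * b) = const k * p2 a b"
      "\<And>k a b. p12 (const k * a) (const k * b) = const k * p12 a b"
  shows "even_operator P"
proof -
  have zero: "p0 0 0 = 0" "p1 0 0 = 0" "p2 0 0 = 0" "p12 0 0 = 0"
    using lin(1-4)[of 0 0 0 0] by simp_all
  have P: "P F \<doteq> sf (p0 a d) (p1 b c) (p2 b c) (p12 a d)" if "F \<doteq> sf a b c d" for F a b c d
    using eq_on_siegel_trans[OF cong[OF that] sf] .
  show ?thesis
    unfolding even_operator_def
  proof (intro conjI ballI impI allI)
    fix F assume "F \<in> superfunctions"
    then obtain a b c d where F: "F \<doteq> sf a b c d" by (rule superfunction_sf)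
    show "P F \<in> superfunctions"
      using superfunctions_cong[OF P[OF F] sf_in_superfunctions] .
    show "even_superfun (P F)" if "even_superfun F"
      using that by (simp add: even_superfun_cong[OF F] even_superfun_cong[OF P[OF F]] even_sf zero)
    show "odd_superfun (P F)" if "odd_superfun F"
      using that by (simp add: odd_superfun_cong[OF F] odd_superfun_cong[OF P[OF F]] odd_sf zero)
    show "P (\<lambda>v. gconst k * F v) \<doteq> (\<lambda>v. gconst k * P F v)" for k
    proof -
      have "(\<lambda>v. gconst k * F v) \<doteq> sf (const k * a) (const k * b) (const k * c) (const k * d)"
        using F by (simp add: eq_on_siegel_def flip: sf_scale)
      from P[OF this] P[OF F] show ?thesis
        by (simp add: lin eq_on_siegel_def flip: sf_scale)
    qed
    fix G assume "G \<in> superfunctions"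
    then obtain a' b' c' d' where G: "G \<doteq> sf a' b' c' d'" by (rule superfunction_sf)
    show "P (\<lambda>v. F v + G v) \<doteq> (\<lambda>v. P F v + P G v)"
    proof -
      have "(\<lambda>v. F v + G v) \<doteq> sf (a + a') (b + b') (c + c') (d + d')"
        using F G by (simp add: eq_on_siegel_def flip: sf_add)
      from P[OF this] P[OF F] P[OF G] show ?thesis
        by (simp add: lin eq_on_siegel_def flip: sf_add)
    qed
  qed (rule cong)
qed

lemma even_operator_DD: "even_operator DD"
  by (rule even_operatorI[where P = DD, OF DD_cong DD_sf]) (simp_all add: del_simps algebra_simps)

lemma parity_DD_sf: "parity (DD (sf a b c d)) \<doteq>
    sf (- 2 * d) (- (2 * (del 1 2 b - del 1 1 c))) (- (2 * (del 2 2 b - del 1 2 c)))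
    (2 * (del 1 1 (del 2 2 a) - del 1 2 (del 1 2 a)))"
  using parity_cong[OF DD_sf[of a b c d]] by (simp only: parity_sf)

lemma even_operator_parity_DD: "even_operator (\<lambda>F. parity (DD F))"
  by (rule even_operatorI[where P = "\<lambda>F. parity (DD F)", OF parity_cong[OF DD_cong] parity_DD_sf])
     (simp_all add: del_simps algebra_simps)

text \<open>An odd generator sends a, d into the odd slots and b, c into the even ones, so the sign
  moves to the other half of the components.\<close>

lemma parity_odd_act:
  assumes "F \<in> superfunctions"
  shows "parity (odd_act r y F) \<doteq> (\<lambda>v. - odd_act r y (parity F) v)"
proof (cases y)
  case (Pair \<alpha> \<beta>)
  obtain a b c d where F: "F \<doteq> sf a b c d" using superfunction_sf[OF assms] .
  show ?thesis
  proof (rule eq_on_siegelI)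
    fix v assume v: "v \<in> siegel"
    have 1: "parity F \<doteq> sf a (- b) (- c) d"
      using parity_cong[OF F] by (simp only: parity_sf)
    show "parity (odd_act r y F) v = - odd_act r y (parity F) v"
      unfolding Pair eq_on_siegelD[OF parity_cong[OF eq_on_siegel_trans[OF odd_act_cong[OF F] odd_act_sf]] v]
        eq_on_siegelD[OF eq_on_siegel_trans[OF odd_act_cong[OF 1] odd_act_sf] v] parity_sf
      using v by (simp add: sf_def grass_simps del_simps ev_simps algebra_simps)
  qed
qed

lemma even_operatorD:
  assumes "even_operator P"
  shows "F \<in> superfunctions \<Longrightarrow> P F \<in> superfunctions"
    and "F \<in> superfunctions \<Longrightarrow> G \<in> superfunctions \<Longrightarrow> F \<doteq> G \<Longrightarrow> P F \<doteq> P G"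
    and "F \<in> superfunctions \<Longrightarrow> G \<in> superfunctions \<Longrightarrow> P (\<lambda>v. F v + G v) \<doteq> (\<lambda>v. P F v + P G v)"
  using assms by (simp_all add: even_operator_def)

text \<open>The sign of skew-invariance cancels the sign picked up when \<open>parity\<close> passes
  an odd generator.\<close>

lemma parity_DD_odd_act:
  assumes F: "F \<in> superfunctions"
  shows "odd_act (3/2) y (parity (DD F)) \<doteq> parity (DD (odd_act (1/2) y F))"
proof -
  have "(\<lambda>v. - odd_act (3/2) y (DD F) v) \<doteq> DD (odd_act (1/2) y F)"
    using DD_odd_act[OF F] by (simp add: eq_on_siegel_def)
  from parity_cong[OF this]
  have "(\<lambda>v. - parity (odd_act (3/2) y (DD F)) v) \<doteq> parity (DD (odd_act (1/2) y F))"
    by (simp add: parity_def grass_simps)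
  moreover have "parity (odd_act (3/2) y (DD F)) \<doteq> (\<lambda>v. - odd_act (3/2) y (parity (DD F)) v)"
    by (intro parity_odd_act even_operatorD(1)[OF even_operator_DD] F)
  ultimately show ?thesis by (simp add: eq_on_siegel_def)
qed

text \<open>Even elements act as anticommutators of odd ones, so it suffices to apply
  \<open>odd\<close> twice and use additivity of P.\<close>

lemma bracket_act_commute:
  assumes P: "even_operator P"
    and odd: "\<And>y F. F \<in> superfunctions \<Longrightarrow> odd_act r' y (P F) \<doteq> P (odd_act r y F)"
    and F: "F \<in> superfunctions"
  shows "bracket_act r' y y' (P F) \<doteq> P (bracket_act r y y' F)"
proof -
  have 2: "odd_act r' y (odd_act r' y' (P F)) \<doteq> P (odd_act r y (odd_act r y' F))" for y y'
    using odd_act_cong[OF odd[OF F]] odd[OF odd_act_in_superfunctions[OF F]]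
    by (rule eq_on_siegel_trans)
  have "P (bracket_act r y y' F) \<doteq>
      (\<lambda>v. P (odd_act r y (odd_act r y' F)) v + P (odd_act r y' (odd_act r y F)) v)"
    unfolding bracket_act_def
    by (intro even_operatorD(3)[OF P] odd_act_in_superfunctions F)
  then show ?thesis
    using 2[of y y'] 2[of y' y] by (simp add: eq_on_siegel_def bracket_act_def)
qed

lemma grass_const_in_superfunctions: "(\<lambda>v. x) \<in> superfunctions"
  by (simp add: superfunctions_def o_def holomorphic_siegel_const)

lemma super_diff_op_Dop: "super_diff_op (Dop i)"
proof -
  have "Dop i = (\<lambda>F v. dxi i F v + (((\<lambda>F v. - xi$1 * F v) \<circ> dv i 1) F v + ((\<lambda>F v. - xi$2 * F v) \<circ> dv i 2) F v))"
    by (simp add: fun_eq_iff Dop_def sum_2)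
  then show ?thesis
    using super_diff_op.intros grass_const_in_superfunctions by presburger
qed

lemma super_diff_op_DD: "super_diff_op DD"
proof -
  have "DD = (\<lambda>F v. (Dop 1 \<circ> Dop 2) F v + ((\<lambda>F v. - 1 * F v) \<circ> (Dop 2 \<circ> Dop 1)) F v)"
    by (simp add: fun_eq_iff DD_def)
  moreover have "super_diff_op \<dots>"
    by (intro super_diff_op.add super_diff_op.comp super_diff_op_Dop
        super_diff_op.mult[OF grass_const_in_superfunctions])
  ultimately show ?thesis by simp
qed

section \<open>The symplectic action on the Siegel space\<close>

text \<open>Stated over \<open>ring_1\<close> because it serves matrices over the noncommutative
  \<open>grass\<close> as well as complex ones.\<close>

lemma matrix_inv_unique:
  fixes A :: "'a::ring_1^'n^'n"
  assumes "A ** B = mat 1" "B ** A = mat 1"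
  shows "matrix_inv A = B"
proof -
  have "\<exists>A'. A ** A' = mat 1 \<and> A' ** A = mat 1" using assms by blast
  then have "A ** matrix_inv A = mat 1"
    unfolding matrix_inv_def by (rule someI2_ex) simp
  then have "B ** (A ** matrix_inv A) = B" by simp
  then show ?thesis by (simp add: matrix_mul_assoc assms)
qed

lemma matrix_diff_ldistrib: "A ** (B - C) = A ** B - A ** C"
  and matrix_diff_rdistrib: "(A - B) ** C = A ** C - B ** C"
  and matrix_minus_left: "(- A) ** C = - (A ** C)"
  and matrix_minus_right: "A ** (- C) = - (A ** C)"
  for A B C :: "'a::ring_1^2^2"
  by (simp_all add: vec_eq_iff matrix_matrix_mult_def sum_2 algebra_simps)

lemma transpose_diff: "transpose (A - B) = transpose A - transpose B"
  and transpose_0: "transpose (0::'a^2^2) = 0"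
  for A B :: "'a::ring_1^2^2"
  by (simp_all add: vec_eq_iff transpose_def)

definition cblock :: "(2 \<Rightarrow> 2 + 2) \<Rightarrow> (2 \<Rightarrow> 2 + 2) \<Rightarrow> real^(2+2)^(2+2) \<Rightarrow> complex^2^2" where
  "cblock p q g = (\<chi> i j. of_real (g $ p i $ q j))"

lemma sum_2_plus_2: "(\<Sum>x\<in>(UNIV::(2+2) set). f x) = f (Inl 1) + f (Inl 2) + (f (Inr 1) + f (Inr 2))"
  by (subst UNIV_Plus_UNIV[symmetric], subst sum.Plus) (simp_all add: sum_2)

lemma symplectic_form_entries:
  assumes "g \<in> Sp4"
  shows "(\<Sum>k\<in>UNIV. g $ Inl k $ a * g $ Inr k $ b - g $ Inr k $ a * g $ Inl k $ b) = symplectic_form $ a $ b"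
proof -
  have "(transpose g ** symplectic_form ** g) $ a $ b = symplectic_form $ a $ b"
    using assms by (simp add: Sp4_def)
  then show ?thesis
    by (simp add: matrix_matrix_mult_def transpose_def sum_2_plus_2 sum_2)
       (simp add: symplectic_form_def)
qed

text \<open>The real relations on g are extended complex bilinearly, so that complex vectors and
  their conjugates may be inserted.\<close>

lemma symplectic_invariance:
  fixes X Y :: "2 + 2 \<Rightarrow> complex"
  assumes g: "g \<in> Sp4"
  defines "gX \<equiv> \<lambda>a. \<Sum>b\<in>UNIV. of_real (g$a$b) * X b" and "gY \<equiv> \<lambda>a. \<Sum>b\<in>UNIV. of_real (g$a$b) * Y b"
  shows "(\<Sum>k\<in>UNIV. gY (Inl k) * gX (Inr k) - gY (Inr k) * gX (Inl k)) =
    (\<Sum>k\<in>UNIV. Y (Inl k) * X (Inr k) - Y (Inr k) * X (Inl k))"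
proof -
  have "(\<Sum>k\<in>UNIV. gY (Inl k) * gX (Inr k) - gY (Inr k) * gX (Inl k)) =
      (\<Sum>k\<in>UNIV. \<Sum>a\<in>UNIV. \<Sum>b\<in>UNIV. Y a * X b *
        of_real (g $ Inl k $ a * g $ Inr k $ b - g $ Inr k $ a * g $ Inl k $ b))"
    unfolding gX_def gY_def sum_product sum_subtractf[symmetric]
    by (intro sum.cong refl) (simp add: algebra_simps)
  also have "\<dots> = (\<Sum>a\<in>UNIV. \<Sum>b\<in>UNIV. \<Sum>k\<in>UNIV. Y a * X b *
        of_real (g $ Inl k $ a * g $ Inr k $ b - g $ Inr k $ a * g $ Inl k $ b))"
    by (subst sum.swap, intro sum.cong refl, subst sum.swap) simp
  also have "\<dots> = (\<Sum>a\<in>UNIV. \<Sum>b\<in>UNIV. Y a * X b * of_real (symplectic_form $ a $ b))"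
    by (simp only: sum_distrib_left[symmetric] of_real_sum[symmetric] symplectic_form_entries[OF g])
  also have "\<dots> = (\<Sum>k\<in>UNIV. Y (Inl k) * X (Inr k) - Y (Inr k) * X (Inl k))"
    unfolding sum_2_plus_2 sum_2 by (simp add: symplectic_form_def)
  finally show ?thesis .
qed

text \<open>Since v is symmetric, the cross terms cancel and the imaginary part splits into the real
  quadratic form at Re x plus that at Im x.\<close>

lemma im_form_pos:
  assumes v: "v \<in> siegel" and x: "x \<noteq> 0"
  shows "0 < Im (\<Sum>k\<in>UNIV. cnj (x$k) * (v *v x)$k)"
proof -
  let ?q = "\<lambda>y::real^2. y \<bullet> (map_matrix Im v *v y)"
  have "Im (\<Sum>k\<in>UNIV. cnj (x$k) * (v *v x)$k) = ?q (\<chi> k. Re (x$k)) + ?q (\<chi> k. Im (x$k))"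
    unfolding quadratic_form_2
    by (simp add: sum_2 matrix_vector_mult_def map_matrix_def siegel_entry[OF v]
        power2_eq_square algebra_simps)
  moreover have "0 \<le> ?q y" for y
    using v by (cases "y = 0") (auto simp: siegel_def less_imp_le)
  moreover have "(\<chi> k. Re (x$k)) \<noteq> (0::real^2) \<or> (\<chi> k. Im (x$k)) \<noteq> (0::real^2)"
    using x by (auto simp: vec_eq_iff forall_2 complex_eq_iff)
  then have "0 < ?q (\<chi> k. Re (x$k)) \<or> 0 < ?q (\<chi> k. Im (x$k))"
    using v by (auto simp: siegel_def)
  ultimately show ?thesis by (auto intro: add_nonneg_pos add_pos_nonneg)
qed

section \<open>Symplectic blocks and fractional linear maps\<close>

locale symplectic =
  fixes g :: "real^(2+2)^(2+2)"
  assumes Sp4: "g \<in> Sp4"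
begin

abbreviation "A \<equiv> cblock Inl Inl g"
abbreviation "B \<equiv> cblock Inl Inr g"
abbreviation "C \<equiv> cblock Inr Inl g"
abbreviation "D \<equiv> cblock Inr Inr g"

lemma block_form:
  fixes x1 x2 y1 y2 :: "complex^2"
  shows "(\<Sum>k\<in>UNIV. (A *v y1 + B *v y2)$k * (C *v x1 + D *v x2)$k - (C *v y1 + D *v y2)$k * (A *v x1 + B *v x2)$k)
    = (\<Sum>k\<in>UNIV. y1$k * x2$k - y2$k * x1$k)"
proof -
  have *: "(\<Sum>b\<in>UNIV. of_real (g$p k$b) * case_sum (\<lambda>i. x$i) (\<lambda>i. y$i) b) =
      (cblock p Inl g *v x + cblock p Inr g *v y)$k" for p k and x y :: "complex^2"
    by (simp add: sum_2_plus_2 sum_2 matrix_vector_mult_def cblock_def)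
  show ?thesis
    using symplectic_invariance[OF Sp4, where X = "case_sum (\<lambda>i. x1$i) (\<lambda>i. x2$i)" and Y = "case_sum (\<lambda>i. y1$i) (\<lambda>i. y2$i)"]
    unfolding * by simp
qed

text \<open>With v, 1 and 0 inserted for the X and Y this yields every block relation used below:
  N^T J = J^T N, N^T C - J^T A = - 1 and A^T C = C^T A.\<close>

lemma block_form_matrix:
  fixes X1 X2 Y1 Y2 :: "complex^2^2"
  shows "transpose (A ** Y1 + B ** Y2) ** (C ** X1 + D ** X2) - transpose (C ** Y1 + D ** Y2) ** (A ** X1 + B ** X2)
    = transpose Y1 ** X2 - transpose Y2 ** X1"
proof -
  have *: "(cblock p q g ** X)$k$i = (cblock p q g *v column i X)$k" for p q and X :: "complex^2^2" and k i
    by (simp add: matrix_matrix_mult_def matrix_vector_mult_def column_def)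
  have tm: "(transpose P ** Q)$i$j = (\<Sum>k\<in>UNIV. P$k$i * Q$k$j)" for P Q :: "complex^2^2" and i j
    by (simp add: matrix_matrix_mult_def transpose_def)
  show ?thesis
    using block_form[of "column i Y1" "column i Y2" "column j X1" "column j X2" for i j]
    by (simp only: vec_eq_iff vector_minus_component tm vector_add_component * sum_subtractf)
       (simp add: column_def)
qed

definition J :: "complex^2^2 \<Rightarrow> complex^2^2" where "J v = C ** v + D"
definition N :: "complex^2^2 \<Rightarrow> complex^2^2" where "N v = A ** v + B"
definition M :: "complex^2^2 \<Rightarrow> complex^2^2" where "M v = matrix_inv (J v)"
definition Z :: "complex^2^2 \<Rightarrow> complex^2^2" where "Z v = N v ** M v"
definition S :: "complex^2^2 \<Rightarrow> complex^2^2" where "S v = M v ** C"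

context
  fixes v :: "complex^2^2"
  assumes v: "v \<in> siegel"
begin

text \<open>g is real and maps the pair (v x, x) to (N x, J x), so it maps the conjugate pair to the
  conjugate of the image. The symplectic pairing of a pair with its conjugate is - 2 i times the
  imaginary part in question.\<close>

lemma im_form_transform:
  "Im (\<Sum>k\<in>UNIV. cnj ((J v *v x)$k) * (N v *v x)$k) = Im (\<Sum>k\<in>UNIV. cnj (x$k) * (v *v x)$k)"
proof -
  let ?c = "\<lambda>x. (\<chi> k. cnj (x$k)) :: complex^2"
  have J: "J v *v x = C *v (v *v x) + D *v x" and N: "N v *v x = A *v (v *v x) + B *v x"
    by (simp_all add: J_def N_def matrix_vector_mult_add_rdistrib matrix_vector_mul_assoc)
  have cJ: "?c (J v *v x) = C *v ?c (v *v x) + D *v ?c x" and cN: "?c (N v *v x) = A *v ?c (v *v x) + B *v ?c x"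
    unfolding J N by (simp_all add: vec_eq_iff matrix_vector_mult_def sum_2 cblock_def)
  have im: "Im z = Im w" if "cnj z - z = cnj w - w" for z w
    using that by (simp add: complex_eq_iff)
  show ?thesis
  proof (rule im)
    show "cnj (\<Sum>k\<in>UNIV. cnj ((J v *v x)$k) * (N v *v x)$k) - (\<Sum>k\<in>UNIV. cnj ((J v *v x)$k) * (N v *v x)$k)
      = cnj (\<Sum>k\<in>UNIV. cnj (x$k) * (v *v x)$k) - (\<Sum>k\<in>UNIV. cnj (x$k) * (v *v x)$k)"
      using block_form[of "?c (v *v x)" "?c x" "v *v x" x]
      unfolding cJ[symmetric] cN[symmetric] J[symmetric] N[symmetric]
      by (simp add: sum_subtractf mult.commute)
  qed
qed

text \<open>If J x = 0, the left side of \<open>im_form_transform\<close> vanishes, which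
  \<open>im_form_pos\<close> excludes for x \<noteq> 0.\<close>

lemma J_inverse: "M v ** J v = mat 1" "J v ** M v = mat 1"
proof -
  have "x = 0" if "J v *v x = 0" for x
    using im_form_transform[of x] im_form_pos[OF v, of x] that by auto
  then have "invertible (J v)"
    by (simp add: invertible_left_inverse matrix_left_invertible_ker)
  then show "M v ** J v = mat 1" "J v ** M v = mat 1"
    unfolding M_def invertible_def using matrix_inv_unique[of "J v"] by auto
qed

lemma Z_J: "Z v ** J v = N v"
  by (simp add: Z_def J_inverse flip: matrix_mul_assoc)

text \<open>Multiply N^T J = J^T N by M^T on the left and by M on the right.\<close>

lemma Z_symmetric: "transpose (Z v) = Z v"
proof -
  have "transpose (N v) ** J v = transpose (J v) ** N v"
    using block_form_matrix[of v "mat 1" v "mat 1"] siegel_symmetric[OF v]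
    by (simp add: J_def N_def transpose_mat)
  then have "transpose (M v) ** (transpose (N v) ** J v) ** M v = transpose (M v) ** (transpose (J v) ** N v) ** M v"
    by simp
  moreover have "transpose (M v) ** transpose (J v) = mat 1"
    by (simp add: J_inverse transpose_mat flip: matrix_transpose_mul)
  ultimately show ?thesis
    by (simp add: Z_def matrix_transpose_mul matrix_mul_assoc)
       (simp add: J_inverse flip: matrix_mul_assoc)
qed

text \<open>Follows from N^T C - J^T A = - 1 and the symmetry of Z. It turns the derivative of Z J =
  N into dZ = M^T w M, and it puts the soul of the transformed T into the form M^T nil M.\<close>

lemma Z_C: "A - Z v ** C = transpose (M v)"
proof -
  have "transpose (N v) ** C - transpose (J v) ** A = - mat 1"
    using block_form_matrix[of v "mat 1" "mat 1" 0] by (simp add: J_def N_def transpose_mat)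
  then have "transpose (M v) ** (transpose (N v) ** C - transpose (J v) ** A) = - transpose (M v)"
    by (simp add: matrix_minus_right)
  moreover have "transpose (M v) ** transpose (N v) = Z v"
    using Z_symmetric by (simp add: Z_def matrix_transpose_mul)
  moreover have "transpose (M v) ** transpose (J v) = mat 1"
    by (simp add: J_inverse transpose_mat flip: matrix_transpose_mul)
  ultimately show ?thesis
    by (simp add: matrix_diff_ldistrib matrix_mul_assoc algebra_simps)
qed

text \<open>S^T = C^T M^T = C^T A - C^T Z C, and both terms are symmetric.\<close>

lemma S_symmetric: "transpose (S v) = S v"
proof -
  have AC: "transpose A ** C = transpose C ** A"
    using block_form_matrix[of "mat 1" 0 "mat 1" 0] by (simp add: transpose_mat transpose_0)
  have "transpose (S v) = transpose C ** (A - Z v ** C)"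
    unfolding Z_C by (simp add: S_def matrix_transpose_mul)
  also have "transpose \<dots> = \<dots>"
    by (simp add: matrix_diff_ldistrib transpose_diff matrix_transpose_mul Z_symmetric AC matrix_mul_assoc)
  finally show ?thesis
    using \<open>transpose (S v) = transpose C ** (A - Z v ** C)\<close> by (metis transpose_transpose)
qed

lemma Z_siegel: "Z v \<in> siegel"
proof -
  have "0 < y \<bullet> (map_matrix Im (Z v) *v y)" if y: "y \<noteq> 0" for y :: "real^2"
  proof -
    define cy where "cy = (\<chi> k. complex_of_real (y$k))"
    \<comment> \<open>The preimage of y under J, so that the Hermitian form of Z at y has the same
      imaginary part as that of v at x.\<close>
    define x where "x = M v *v cy"
    have Jx: "J v *v x = cy" and Nx: "N v *v x = Z v *v cy"
      by (simp_all add: x_def Z_def matrix_vector_mul_assoc J_inverse)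
    have "cy \<noteq> 0" using y by (simp add: cy_def vec_eq_iff)
    then have "x \<noteq> 0" using Jx by auto
    then have "0 < Im (\<Sum>k\<in>UNIV. cnj (cy$k) * (Z v *v cy)$k)"
      using im_form_transform[of x] im_form_pos[OF v] by (simp add: Jx Nx)
    also have "\<dots> = y \<bullet> (map_matrix Im (Z v) *v y)"
      unfolding quadratic_form_2
      by (simp add: cy_def sum_2 matrix_vector_mult_def map_matrix_def power2_eq_square algebra_simps)
    finally show ?thesis .
  qed
  then show ?thesis by (simp add: siegel_def Z_symmetric)
qed

lemma det_M: "det (M v) * det (J v) = 1" "det (J v) \<noteq> 0"
proof -
  show "det (M v) * det (J v) = 1"
    using det_mul[of "M v" "J v"] by (simp add: J_inverse)
  then show "det (J v) \<noteq> 0" by auto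
qed

end

end

section \<open>The even group\<close>

lemma matrix_0_left: "0 ** (X :: complex^2^2) = (0 :: complex^2^2)"
  by (simp add: vec_eq_iff matrix_matrix_mult_def)

text \<open>Stands for P + Q xi_1 xi_2. Since xi_1 xi_2 has square zero and commutes with
  everything, such matrices multiply like matrices over dual numbers.\<close>

definition gmat :: "complex^2^2 \<Rightarrow> complex^2^2 \<Rightarrow> grass^2^2" where
  "gmat P Q = (\<chi> i j. Grass (P$i$j) 0 0 (Q$i$j))"

lemma gmat_mult: "gmat P Q ** gmat P' Q' = gmat (P ** P') (P ** Q' + Q ** P')"
  by (simp add: vec_eq_iff gmat_def matrix_matrix_mult_def sum_2 grass_simps)

lemma gmat_add: "gmat P Q + gmat P' Q' = gmat (P + P') (Q + Q')"
  by (simp add: vec_eq_iff gmat_def grass_simps)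

lemma mat_1_gmat: "mat 1 = gmat (mat 1) 0"
  by (simp add: vec_eq_iff gmat_def mat_def grass_simps)

lemma block_gmat: "block p q g = gmat (cblock p q g) 0"
  by (simp add: vec_eq_iff gmat_def block_def cblock_def grass_simps)

text \<open>The coefficient of xi_1 xi_2 in \<^const>\<open>Tmat\<close>.\<close>

definition nil :: "complex^2^2" where
  "nil = (\<chi> i j. if i = j then 0 else if i = 1 then - (1/2) else 1/2)"

lemma Tmat_gmat: "Tmat v = gmat v nil"
  by (simp add: vec_eq_iff forall_2 gmat_def Tmat_def nil_def xi_def grass_simps)

text \<open>\<open>nil\<close> is - 1/2 times the standard alternating form, which congruence
  multiplies by the determinant.\<close>

lemma congruence_nil: "transpose P ** nil ** P = smat (det P) nil"
  by (simp add: vec_eq_iff forall_2 det_2 matrix_matrix_mult_def sum_2 nil_def transpose_def algebra_simps)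

locale metaplectic = symplectic +
  fixes s :: real and \<phi> :: superfun
  assumes OMp: "(s, g, \<phi>) \<in> OMp_even"
begin

context
  fixes v :: "complex^2^2"
  assumes v: "v \<in> siegel"
begin

lemma aut_gmat: "aut g v = gmat (J v) (C ** nil)"
  by (simp add: aut_def block_gmat Tmat_gmat gmat_mult gmat_add J_def matrix_0_left)

text \<open>The geometric series for the inverse of J + C nil xi_1 xi_2 stops after the linear
  term.\<close>

lemma matrix_inv_aut: "matrix_inv (aut g v) = gmat (M v) (- (M v ** (C ** nil) ** M v))"
proof (rule matrix_inv_unique)
  have *: "J v ** (M v ** X) = X" "M v ** (J v ** X) = X" for X
    by (simp_all add: matrix_mul_assoc J_inverse[OF v])
  show "aut g v ** gmat (M v) (- (M v ** (C ** nil) ** M v)) = mat 1"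
    unfolding aut_gmat gmat_mult
    by (simp add: J_inverse[OF v] mat_1_gmat matrix_minus_right * flip: matrix_mul_assoc)
  show "gmat (M v) (- (M v ** (C ** nil) ** M v)) ** aut g v = mat 1"
    unfolding aut_gmat gmat_mult
    by (simp add: J_inverse[OF v] mat_1_gmat matrix_minus_left * flip: matrix_mul_assoc)
qed

text \<open>The soul is (A - Z C) nil M; \<open>Z_C\<close> makes it M^T nil M, and
  \<open>congruence_nil\<close> evaluates that.\<close>

lemma fractional_linear_gmat:
  "(blockA g ** Tmat v + blockB g) ** matrix_inv (aut g v) = gmat (Z v) (smat (det (M v)) nil)"
proof -
  have "(blockA g ** Tmat v + blockB g) ** matrix_inv (aut g v) =
      gmat (Z v) (A ** nil ** M v - Z v ** C ** nil ** M v)"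
    by (simp add: matrix_inv_aut block_gmat Tmat_gmat gmat_mult gmat_add matrix_0_left N_def[symmetric]
        Z_def matrix_minus_right matrix_mul_assoc)
  also have "A ** nil ** M v - Z v ** C ** nil ** M v = (A - Z v ** C) ** nil ** M v"
    by (simp add: matrix_diff_rdistrib)
  also have "\<dots> = smat (det (M v)) nil"
    by (simp add: Z_C[OF v] congruence_nil)
  finally show ?thesis .
qed

lemma sgn_sq: "complex_of_real s * complex_of_real s = 1"
  using OMp by (auto simp: OMp_even_def)

text \<open>Multiplication by xi_i kills the soul of the inverse matrix.\<close>

lemma odd_coordinates:
  "gconst (of_real s) *s (xi v* matrix_inv (aut g v)) = (\<chi> j. Grass 0 (of_real s * M v$1$j) (of_real s * M v$2$j) 0)"
  by (simp add: vec_eq_iff matrix_inv_aut vector_matrix_mult_def sum_2 xi_def gmat_def grass_simps)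

lemma superval_transform:
  "superval F ((blockA g ** Tmat v + blockB g) ** matrix_inv (aut g v))
      (gconst (of_real s) *s (xi v* matrix_inv (aut g v))) =
    Grass (c0 (F (Z v)))
      (of_real s * (M v$1$1 * c1 (F (Z v)) + M v$1$2 * c2 (F (Z v))))
      (of_real s * (M v$2$1 * c1 (F (Z v)) + M v$2$2 * c2 (F (Z v))))
      (det (M v) * c12 (F (Z v)))"
proof -
  have sgn: "of_real s * (of_real s * x) = x" "of_real s * (x * (of_real s * y)) = x * y" for x y :: complex
    using sgn_sq by (metis mult.assoc mult.left_commute mult_1)+
  let ?x = "\<chi> j. Grass 0 (of_real s * M v$1$j) (of_real s * M v$2$j) 0"
  \<comment> \<open>Here the soul cancels: x_1 x_2 = s^2 det M xi_1 xi_2 with s^2 = 1, and half of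
    it is opposite to the (1,2) entry - det M / 2 of the soul of T.\<close>
  have "(\<chi> i j. gmat (Z v) (smat (det (M v)) nil)$i$j + gconst (1/2) * (?x$i * ?x$j)) = gmat (Z v) 0"
    by (simp add: vec_eq_iff forall_2 gmat_def nil_def grass_simps det_2 field_simps sgn)
  moreover have "map_matrix c0 (gmat (Z v) 0) = Z v" "map_matrix c12 (gmat (Z v) 0) = 0"
    by (simp_all add: vec_eq_iff gmat_def map_matrix_def)
  moreover have "smat z 0 = 0" for z by (simp add: vec_eq_iff)
  ultimately show ?thesis
    unfolding fractional_linear_gmat odd_coordinates superval_def
    by (simp add: geval_def Let_def grass_simps)
      (simp add: det_2 algebra_simps sgn)
qed

text \<open>Since C = J S, det(J + C nil xi_1 xi_2) = det J (1 + tr(S nil) xi_1 xi_2), and the trace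
  of a symmetric times an alternating matrix is 0. As \<open>c0 (\<phi> v)\<close> is nonzero, the
  soul of its square vanishes only if its own soul does.\<close>

lemma phi_sq: "\<phi> v = gconst (c0 (\<phi> v))" "(c0 (\<phi> v))\<^sup>2 = det (J v)"
proof -
  have even: "c1 (\<phi> v) = 0" "c2 (\<phi> v) = 0" and sq: "(\<phi> v)\<^sup>2 = gdet (aut g v)"
    using OMp v by (auto simp: OMp_even_def even_superfun_def even_grass_def)
  have C: "C = J v ** S v"
    by (simp add: S_def matrix_mul_assoc J_inverse[OF v])
  have S21: "S v$2$1 = S v$1$2"
    using S_symmetric[OF v] by (simp add: transpose_eq_iff_2)
  have "gdet (gmat (J v) (J v ** S v ** nil)) = gconst (det (J v))"
    by (simp add: gdet_def gmat_def grass_simps det_2 matrix_matrix_mult_def sum_2 nil_def S21 algebra_simps)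
  then have "gdet (aut g v) = gconst (det (J v))"
    unfolding aut_gmat C[symmetric] .
  with sq even have "c0 (\<phi> v) * c0 (\<phi> v) = det (J v)" "c0 (\<phi> v) * c12 (\<phi> v) + c12 (\<phi> v) * c0 (\<phi> v) = 0"
    by (auto simp: power2_eq_square grass_simps)
  then show "(c0 (\<phi> v))\<^sup>2 = det (J v)" "\<phi> v = gconst (c0 (\<phi> v))"
    using det_M(2)[OF v] even by (auto simp: power2_eq_square gconst_def grass.expand)
qed

end

end

section \<open>Derivatives of the matrices J, M, S and Z\<close>

lemma holomorphic_siegel_minus: "holomorphic_siegel f \<Longrightarrow> holomorphic_siegel (\<lambda>v. - f v)"
  using holomorphic_siegel_mult[OF holomorphic_siegel_const[of "- 1"]] by simp

definition mhol :: "(complex^2^2 \<Rightarrow> complex^2^2) \<Rightarrow> bool" where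
  "mhol F \<longleftrightarrow> (\<forall>i j. holomorphic_siegel (\<lambda>v. F v$i$j))"

definition mpd :: "2 \<Rightarrow> 2 \<Rightarrow> (complex^2^2 \<Rightarrow> complex^2^2) \<Rightarrow> complex^2^2 \<Rightarrow> complex^2^2" where
  "mpd k l F v = (\<chi> i j. pd k l (\<lambda>v. F v$i$j) v)"

lemma mpd_nth [simp]: "mpd k l F v $ i $ j = pd k l (\<lambda>v. F v$i$j) v"
  by (simp add: mpd_def)

lemma mhol_mult: "mhol F \<Longrightarrow> mhol G \<Longrightarrow> mhol (\<lambda>v. F v ** G v)"
  by (simp add: mhol_def matrix_matrix_mult_def sum_2 holomorphic_siegel_add holomorphic_siegel_mult)

lemma mhol_add: "mhol F \<Longrightarrow> mhol G \<Longrightarrow> mhol (\<lambda>v. F v + G v)"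
  by (simp add: mhol_def holomorphic_siegel_add)

lemma mhol_const: "mhol (\<lambda>v. P)"
  by (simp add: mhol_def holomorphic_siegel_const)

lemma mhol_id: "mhol (\<lambda>v. v)"
  by (simp add: mhol_def holomorphic_siegel_entry)

text \<open>The symmetrized matrix unit (E_kl + E_lk) / 2, the direction w along which
  \<open>pd k l\<close> differentiates.\<close>

definition sym_unit :: "2 \<Rightarrow> 2 \<Rightarrow> complex^2^2" where
  "sym_unit k l = (\<chi> i j. ((if k = i \<and> l = j then 1 else 0) + (if l = i \<and> k = j then 1 else 0)) / 2)"

context
  fixes v :: "complex^2^2"
  assumes v: "v \<in> siegel"
begin

lemma mpd_mult:
  assumes "mhol F" "mhol G"
  shows "mpd k l (\<lambda>v. F v ** G v) v = mpd k l F v ** G v + F v ** mpd k l G v"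
  using assms v
  by (simp add: vec_eq_iff mhol_def matrix_matrix_mult_def sum_2 pd_add pd_mult holomorphic_siegel_mult
      algebra_simps)

lemma mpd_add: "mhol F \<Longrightarrow> mhol G \<Longrightarrow> mpd k l (\<lambda>v. F v + G v) v = mpd k l F v + mpd k l G v"
  using v by (simp add: vec_eq_iff mhol_def pd_add)

lemma mpd_const: "mpd k l (\<lambda>v. P) v = 0"
  using v by (simp add: vec_eq_iff pd_const)

lemma mpd_id: "mpd k l (\<lambda>v. v) v = sym_unit k l"
  using v by (simp add: vec_eq_iff pd_entry sym_unit_def)

lemma mpd_cong: "(\<And>v. v \<in> siegel \<Longrightarrow> F v = G v) \<Longrightarrow> mpd k l F v = mpd k l G v"
  using v by (simp add: vec_eq_iff) (intro allI pd_cong, simp_all)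

end

lemma sym_unit_conj:
  "(P ** sym_unit k l ** Q)$i$j = (P$i$k * Q$l$j + P$i$l * Q$k$j) / 2"
  using exhaust_2[of k] exhaust_2[of l]
  by (elim disjE) (simp_all add: matrix_matrix_mult_def sum_2 sym_unit_def field_simps)

context metaplectic
begin

lemma mhol_J: "mhol J" and mhol_N: "mhol N"
  unfolding J_def[abs_def] N_def[abs_def] by (intro mhol_add mhol_mult mhol_const mhol_id)+

lemma holomorphic_det_J: "holomorphic_siegel (\<lambda>v. det (J v))"
proof -
  have "det (J v) = J v$1$1 * J v$2$2 + - (J v$1$2 * J v$2$1)" for v
    by (simp add: det_2)
  then show ?thesis
    using mhol_J unfolding mhol_def
    by (simp only:) (intro holomorphic_siegel_add holomorphic_siegel_mult holomorphic_siegel_minus; simp)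
qed

text \<open>\<open>matrix_inv\<close> is defined by choice, so holomorphy of M is read off Cramer's
  rule.\<close>

lemma M_cofactor:
  assumes v: "v \<in> siegel"
  shows "M v = (\<chi> i j. (if i = j then if i = 1 then J v$2$2 else J v$1$1 else - J v$i$j) * inverse (det (J v)))"
    (is "_ = ?M")
proof -
  have "det (J v) * inverse (det (J v)) = 1"
    using det_M(2)[OF v] by simp
  then have "J v ** ?M = mat 1"
    by (simp add: vec_eq_iff forall_2 matrix_matrix_mult_def sum_2 mat_def det_2 algebra_simps)
  moreover have "M v ** (J v ** ?M) = ?M"
    by (simp add: matrix_mul_assoc J_inverse[OF v])
  ultimately show ?thesis by simp
qed

lemma mhol_M: "mhol M"
proof -
  have "holomorphic_siegel (\<lambda>v. (if i = j then if i = 1 then J v$2$2 else J v$1$1 else - J v$i$j) * inverse (det (J v)))" for i j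
    using mhol_J unfolding mhol_def
    by (cases "i = j"; cases "i = 1")
       (auto intro!: holomorphic_siegel_minus holomorphic_siegel_mult holomorphic_siegel_inverse
         holomorphic_det_J det_M(2))
  then show ?thesis
    unfolding mhol_def by (subst holomorphic_siegel_cong[OF M_cofactor[THEN arg_cong[where f = "\<lambda>x. x$i$j" for i j]]]) simp_all
qed

lemma mhol_Z: "mhol Z" and mhol_S: "mhol S"
  unfolding Z_def[abs_def] S_def[abs_def] by (intro mhol_mult mhol_M mhol_N mhol_const)+

context
  fixes v :: "complex^2^2"
  assumes v: "v \<in> siegel"
begin

lemma mpd_J: "mpd k l J v = C ** sym_unit k l"
  and mpd_N: "mpd k l N v = A ** sym_unit k l"
  unfolding J_def[abs_def] N_def[abs_def]
  by (simp_all add: mpd_add mpd_mult mhol_mult mhol_const mhol_id mpd_const mpd_id v matrix_0_left)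

text \<open>Differentiate M J = 1 and multiply by M on the right.\<close>

lemma mpd_M: "mpd k l M v = - (S v ** sym_unit k l ** M v)"
proof -
  have "mpd k l (\<lambda>v. M v ** J v) v = mpd k l (\<lambda>v. mat 1) v"
    by (rule mpd_cong[OF v]) (rule J_inverse)
  then have "mpd k l M v ** J v = - (S v ** sym_unit k l)"
    by (simp add: mpd_mult v mhol_M mhol_J mpd_const mpd_J S_def matrix_mul_assoc eq_neg_iff_add_eq_0)
  then have "mpd k l M v ** J v ** M v = - (S v ** sym_unit k l ** M v)"
    by (simp add: matrix_minus_left)
  then show ?thesis by (simp add: J_inverse[OF v] flip: matrix_mul_assoc)
qed

lemma mpd_S: "mpd k l S v = - (S v ** sym_unit k l ** S v)"
  unfolding S_def[abs_def]
  by (simp add: mpd_mult v mhol_M mhol_const mpd_const mpd_M)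
     (simp add: S_def matrix_minus_left matrix_mul_assoc)

text \<open>Differentiating Z J = N gives dZ J = (A - Z C) w, and \<open>Z_C\<close> replaces the
  bracket by M^T.\<close>

lemma mpd_Z: "mpd k l Z v = transpose (M v) ** sym_unit k l ** M v"
proof -
  have "mpd k l (\<lambda>v. Z v ** J v) v = mpd k l N v"
    by (rule mpd_cong[OF v]) (rule Z_J)
  then have "mpd k l Z v ** J v = A ** sym_unit k l - Z v ** C ** sym_unit k l"
    by (simp add: mpd_mult v mhol_Z mhol_J mpd_N mpd_J matrix_mul_assoc eq_diff_eq)
  then have "mpd k l Z v ** J v ** M v = (A - Z v ** C) ** sym_unit k l ** M v"
    by (simp add: matrix_diff_rdistrib)
  then show ?thesis by (simp add: J_inverse[OF v] Z_C[OF v] flip: matrix_mul_assoc)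
qed

end

end

section \<open>The group action inside the ring of holomorphic functions\<close>

context metaplectic
begin

definition Mh :: "2 \<Rightarrow> 2 \<Rightarrow> holfun" where "Mh i j = holfun (\<lambda>v. M v$i$j)"
definition Sh :: "2 \<Rightarrow> 2 \<Rightarrow> holfun" where "Sh i j = holfun (\<lambda>v. S v$i$j)"
text \<open>With 1/phi as a ring element, the factor phi^(-2r) becomes the power 2r of
  \<open>h\<close>.\<close>

definition h :: holfun where "h = holfun (\<lambda>v. inverse (c0 (\<phi> v)))"
definition pb :: "holfun \<Rightarrow> holfun" where "pb x = holfun (\<lambda>v. ev x (Z v))"

lemma holomorphic_phi: "holomorphic_siegel (\<lambda>v. c0 (\<phi> v))"
  using OMp by (simp add: OMp_even_def superfunctions_def o_def)

context
  fixes v :: "complex^2^2"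
  assumes v: "v \<in> siegel"
begin

lemma phi_nonzero: "c0 (\<phi> v) \<noteq> 0"
  using phi_sq(2)[OF v] det_M(2)[OF v] by auto

text \<open>Jacobi's formula gives d det J = det J tr(S w). The square root halves it, and for
  symmetric S the trace against \<open>sym_unit k l\<close> is S_kl.\<close>

lemma pd_phi: "pd k l (\<lambda>v. c0 (\<phi> v)) v = S v$k$l * c0 (\<phi> v) / 2"
proof -
  let ?f = "\<lambda>v. c0 (\<phi> v)"
  define X where "X = S v ** sym_unit k l"
  have "mpd k l J v = J v ** X"
    by (simp add: mpd_J[OF v] X_def S_def matrix_mul_assoc J_inverse[OF v])
  then have "pd k l (\<lambda>v. J v$i$j) v = (J v ** X)$i$j" for i j
    by (metis mpd_nth)
  moreover have "holomorphic_siegel (\<lambda>v. J v$i$j)" for i j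
    using mhol_J by (simp add: mhol_def)
  ultimately have "pd k l (\<lambda>v. J v$1$1 * J v$2$2 + - 1 * (J v$1$2 * J v$2$1)) v = det (J v) * (X$1$1 + X$2$2)"
    using v by (simp only: pd_add pd_mult pd_const holomorphic_siegel_mult holomorphic_siegel_const
        holomorphic_siegel_add)
      (simp add: det_2 matrix_matrix_mult_def sum_2 algebra_simps)
  also have "X$1$1 + X$2$2 = S v$k$l"
    using exhaust_2[of k] exhaust_2[of l] S_symmetric[OF v]
    by (elim disjE) (simp_all add: X_def matrix_matrix_mult_def sum_2 sym_unit_def transpose_eq_iff_2)
  also have "pd k l (\<lambda>v. J v$1$1 * J v$2$2 + - 1 * (J v$1$2 * J v$2$1)) v = pd k l (\<lambda>v. ?f v * ?f v) v"
    by (rule pd_cong[OF v]) (simp add: phi_sq(2)[unfolded power2_eq_square] flip: det_2)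
  finally have "?f v * (2 * pd k l ?f v) = ?f v * (S v$k$l * ?f v)"
    using v by (simp add: pd_mult holomorphic_phi power2_eq_square algebra_simps flip: phi_sq(2)[OF v])
  then show ?thesis
    using phi_nonzero by (simp add: mult.commute)
qed

end

lemma holomorphic_h: "holomorphic_siegel (\<lambda>v. inverse (c0 (\<phi> v)))"
  by (intro holomorphic_siegel_inverse holomorphic_phi phi_nonzero)

lemma ev_Mh: "v \<in> siegel \<Longrightarrow> ev (Mh i j) v = M v$i$j"
  and ev_Sh: "v \<in> siegel \<Longrightarrow> ev (Sh i j) v = S v$i$j"
  and ev_h: "v \<in> siegel \<Longrightarrow> ev h v = inverse (c0 (\<phi> v))"
  using mhol_M mhol_S holomorphic_h by (simp_all add: mhol_def Mh_def Sh_def h_def ev_holfun)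

lemma holomorphic_pb: "holomorphic_siegel (\<lambda>v. ev x (Z v))"
  by (rule holomorphic_siegel_compose(1)[where f = "ev x" and Z = Z, OF holomorphic_ev Z_siegel])
     (use mhol_Z in \<open>simp_all add: mhol_def\<close>)

lemma ev_pb: "v \<in> siegel \<Longrightarrow> ev (pb x) v = ev x (Z v)"
  by (simp add: pb_def ev_holfun holomorphic_pb)

lemma pb_simps: "pb (x - y) = pb x - pb y" "pb (x * y) = pb x * pb y" "pb (- x) = - pb x"
    "pb (numeral n) = numeral n"
  by (auto intro!: holfun_eqI simp: ev_pb ev_simps Z_siegel)

lemma Sh_sym: "Sh 2 1 = Sh 1 2"
  using S_symmetric by (intro holfun_eqI) (simp add: ev_Sh transpose_eq_iff_2)

text \<open>The link between phi and M: both sides are 1 / det J. It rewrites h^3 as h det M, so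
  that both sides of the equivariance become comparable polynomials.\<close>

lemma h_sq: "h * h = Mh 1 1 * Mh 2 2 - Mh 1 2 * Mh 2 1"
proof (rule holfun_eqI)
  fix v assume v: "v \<in> siegel"
  have "det (M v) * (c0 (\<phi> v))\<^sup>2 = 1"
    using det_M(1)[OF v] phi_sq(2)[OF v] by simp
  then show "ev (h * h) v = ev (Mh 1 1 * Mh 2 2 - Mh 1 2 * Mh 2 1) v"
    using phi_nonzero[OF v] v
    by (simp add: ev_simps ev_h ev_Mh flip: det_2) (simp add: field_simps power2_eq_square)
qed

lemma del_Mh: "del k l (Mh i j) = - const (1/2) * (Sh i k * Mh l j + Sh i l * Mh k j)"
proof (rule holfun_eqI)
  fix v assume v: "v \<in> siegel"
  have "ev (del k l (Mh i j)) v = mpd k l M v $ i $ j"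
    unfolding mpd_nth by (rule pd_ev_cong[OF v ev_Mh])
  then show "ev (del k l (Mh i j)) v = ev (- const (1/2) * (Sh i k * Mh l j + Sh i l * Mh k j)) v"
    using v by (simp add: mpd_M sym_unit_conj ev_simps ev_Sh ev_Mh field_simps)
qed

lemma del_Sh: "del k l (Sh i j) = - const (1/2) * (Sh i k * Sh l j + Sh i l * Sh k j)"
proof (rule holfun_eqI)
  fix v assume v: "v \<in> siegel"
  have "ev (del k l (Sh i j)) v = mpd k l S v $ i $ j"
    unfolding mpd_nth by (rule pd_ev_cong[OF v ev_Sh])
  then show "ev (del k l (Sh i j)) v = ev (- const (1/2) * (Sh i k * Sh l j + Sh i l * Sh k j)) v"
    using v by (simp add: mpd_S sym_unit_conj ev_simps ev_Sh field_simps)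
qed

lemma del_h: "del k l h = - const (1/2) * Sh k l * h"
proof (rule holfun_eqI)
  fix v assume v: "v \<in> siegel"
  let ?f = "\<lambda>v. c0 (\<phi> v)"
  have "pd k l (\<lambda>v. ?f v * inverse (?f v)) v = pd k l (\<lambda>v. 1) v"
    using phi_nonzero by (intro pd_cong[OF v]) simp
  then have "inverse (?f v) * pd k l ?f v + ?f v * pd k l (\<lambda>v. inverse (?f v)) v = 0"
    using v by (simp add: pd_mult pd_const holomorphic_phi holomorphic_h)
  then have "pd k l (\<lambda>v. inverse (?f v)) v = - (S v$k$l * inverse (?f v) / 2)"
    using phi_nonzero[OF v] by (simp add: pd_phi[OF v] field_simps eq_neg_iff_add_eq_0)
  moreover have "ev (del k l h) v = pd k l (\<lambda>v. inverse (?f v)) v"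
    by (rule pd_ev_cong[OF v ev_h])
  ultimately show "ev (del k l h) v = ev (- const (1/2) * Sh k l * h) v"
    using v by (simp add: ev_simps ev_Sh ev_h)
qed

text \<open>The chain rule along M^T w M: the three partial derivatives transform by the symmetric
  square of M, and the middle coefficient collects \<open>del 1 2\<close> and
  \<open>del 2 1\<close>.\<close>

lemma del_pb: "del k l (pb x) = Mh k 1 * Mh l 1 * pb (del 1 1 x)
    + (Mh k 1 * Mh l 2 + Mh k 2 * Mh l 1) * pb (del 1 2 x) + Mh k 2 * Mh l 2 * pb (del 2 2 x)"
    (is "_ = ?R")
proof (rule holfun_eqI)
  fix v assume v: "v \<in> siegel"
  have Z: "pd k l (\<lambda>v. Z v$p$q) v = (M v$k$p * M v$l$q + M v$l$p * M v$k$q) / 2" for p q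
    using arg_cong[OF mpd_Z[OF v, of k l], of "\<lambda>X. X$p$q"]
    by (simp add: sym_unit_conj transpose_def)
  have "ev (del k l (pb x)) v = pd k l (\<lambda>v. ev x (Z v)) v"
    by (rule pd_ev_cong[OF v ev_pb])
  also have "\<dots> = (\<Sum>p\<in>UNIV. \<Sum>q\<in>UNIV. pd p q (ev x) (Z v) * pd k l (\<lambda>v. Z v$p$q) v)"
    by (rule holomorphic_siegel_compose(2)[where f = "ev x" and Z = Z, OF holomorphic_ev Z_siegel _ v])
       (use mhol_Z in \<open>simp_all add: mhol_def\<close>)
  also have "\<dots> = ev ?R v"
    using v by (simp add: Z ev_simps ev_Mh ev_pb ev_del Z_siegel sum_2 pd_commute[of 2 1] field_simps)
  finally show "ev (del k l (pb x)) v = ev ?R v" .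
qed

text \<open>The natural number n stands for 2 r, which turns the integer power of phi into a power
  of \<open>h\<close>; the weights 1/2 and 3/2 are n = 1 and n = 3.\<close>

lemma group_act_sf:
  "group_act (real n / 2) (s, g, \<phi>) (sf a b c d) \<doteq>
    sf (h ^ n * pb a)
       (h ^ n * const (of_real s) * (Mh 1 1 * pb b + Mh 1 2 * pb c))
       (h ^ n * const (of_real s) * (Mh 2 1 * pb b + Mh 2 2 * pb c))
       (h ^ n * (Mh 1 1 * Mh 2 2 - Mh 1 2 * Mh 2 1) * pb d)"
proof (rule eq_on_siegelI)
  fix v assume v: "v \<in> siegel"
  have "gconst x ^ m = gconst (x ^ m)" for x m
    by (induction m) (simp_all add: grass_simps)
  moreover have "inverse (gconst x) = gconst (inverse x)" for x
    by (simp add: inverse_grass_def gconst_def)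
  ultimately have "gconst x powi (- int n) = gconst (inverse x ^ n)" for x
    by (simp add: power_int_def one_grass_def gconst_def)
  then have "\<phi> v powi (- \<lfloor>2 * (real n / 2)\<rfloor>) = gconst (ev h v ^ n)"
    using phi_sq(1)[OF v] by (simp add: ev_h[OF v]) metis
  then show "group_act (real n / 2) (s, g, \<phi>) (sf a b c d) v = sf (h ^ n * pb a)
       (h ^ n * const (of_real s) * (Mh 1 1 * pb b + Mh 1 2 * pb c))
       (h ^ n * const (of_real s) * (Mh 2 1 * pb b + Mh 2 2 * pb c))
       (h ^ n * (Mh 1 1 * Mh 2 2 - Mh 1 2 * Mh 2 1) * pb d) v"
    unfolding group_act_def case_prod_conv superval_transform[OF v]
    using v by (simp add: sf_def grass_simps ev_simps ev_Mh ev_pb det_2)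
qed

lemma group_act_cong:
  assumes "F \<doteq> G"
  shows "group_act r (s, g, \<phi>) F \<doteq> group_act r (s, g, \<phi>) G"
  using assms by (intro eq_on_siegelI)
    (simp add: group_act_def superval_transform eq_on_siegelD[OF assms] Z_siegel)

section \<open>Equivariance under the even group\<close>

lemma h_cube: "h ^ 3 = h * (Mh 1 1 * Mh 2 2 - Mh 1 2 * Mh 2 1)"
  by (simp add: h_sq[symmetric] power3_eq_cube mult.assoc)

lemmas del_pullback_simps = del_Mh del_Sh del_h del_pb Sh_sym

lemma DD_group_act_sf:
  "group_act (3/2) (s, g, \<phi>) (DD (sf a b c d)) \<doteq> DD (group_act (1/2) (s, g, \<phi>) (sf a b c d))"
proof -
  have 3: "group_act (3/2) (s, g, \<phi>) (sf a b c d) \<doteq> sf (h ^ 3 * pb a)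
       (h ^ 3 * const (of_real s) * (Mh 1 1 * pb b + Mh 1 2 * pb c))
       (h ^ 3 * const (of_real s) * (Mh 2 1 * pb b + Mh 2 2 * pb c))
       (h ^ 3 * (Mh 1 1 * Mh 2 2 - Mh 1 2 * Mh 2 1) * pb d)" for a b c d
    using group_act_sf[of 3 a b c d] by simp
  have 1: "group_act (1/2) (s, g, \<phi>) (sf a b c d) \<doteq> sf (h * pb a)
       (h * const (of_real s) * (Mh 1 1 * pb b + Mh 1 2 * pb c))
       (h * const (of_real s) * (Mh 2 1 * pb b + Mh 2 2 * pb c))
       (h * (Mh 1 1 * Mh 2 2 - Mh 1 2 * Mh 2 1) * pb d)"
    using group_act_sf[of 1 a b c d] by simp
  let ?u1 = "h * const (of_real s) * (Mh 1 1 * pb b + Mh 1 2 * pb c)"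
  let ?u2 = "h * const (of_real s) * (Mh 2 1 * pb b + Mh 2 2 * pb c)"
  let ?w1 = "2 * (del 1 2 b - del 1 1 c)" and ?w2 = "2 * (del 2 2 b - del 1 2 c)"
  \<comment> \<open>The \<open>Sh\<close> terms from differentiating \<open>h\<close> cancel those
    from differentiating \<open>Mh\<close>; the first power of \<open>h\<close>, that is r = 1/2, is
    exactly what makes them match. The same happens in \<open>c2\<close>.\<close>
  have c1: "h ^ 3 * const (of_real s) * (Mh 1 1 * pb ?w1 + Mh 1 2 * pb ?w2) = 2 * (del 1 2 ?u1 - del 1 1 ?u2)"
    unfolding h_cube
    by (rule holfun_eqI) (simp add: del_simps pb_simps del_pullback_simps ev_simps field_simps)
  have c2: "h ^ 3 * const (of_real s) * (Mh 2 1 * pb ?w1 + Mh 2 2 * pb ?w2) = 2 * (del 2 2 ?u1 - del 1 2 ?u2)"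
    unfolding h_cube
    by (rule holfun_eqI) (simp add: del_simps pb_simps del_pullback_simps ev_simps field_simps)
  \<comment> \<open>The second-order part acquires (det M)^2, and h (det M)^2 = h^3 det M. Applied
    to \<open>h\<close> alone, a branch of det(J)^(-1/2), the operator gives 0, because - 1/2 is a
    root of the factor s (s + 1/2) in Cayley's identity for symmetric 2 by 2 matrices.\<close>
  have c12: "h ^ 3 * (Mh 1 1 * Mh 2 2 - Mh 1 2 * Mh 2 1) * pb (2 * (del 1 1 (del 2 2 a) - del 1 2 (del 1 2 a)))
      = 2 * (del 1 1 (del 2 2 (h * pb a)) - del 1 2 (del 1 2 (h * pb a)))"
    unfolding h_cube
    by (rule holfun_eqI) (simp add: del_simps pb_simps del_pullback_simps ev_simps field_simps)
  have c0: "h ^ 3 * pb (- 2 * d) = - 2 * (h * (Mh 1 1 * Mh 2 2 - Mh 1 2 * Mh 2 1) * pb d)"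
    by (simp add: h_cube pb_simps)
  show ?thesis
    using eq_on_siegel_trans[OF group_act_cong[OF DD_sf[of a b c d]] 3]
      eq_on_siegel_trans[OF DD_cong[OF 1] DD_sf]
    unfolding c0 c1 c2 c12 by (simp add: eq_on_siegel_def)
qed

text \<open>The action keeps even and odd components apart, so signs on the odd ones can be moved
  through it.\<close>

lemma group_act_parity_sf:
  "parity (group_act (real n / 2) (s, g, \<phi>) (sf a b c d)) \<doteq> group_act (real n / 2) (s, g, \<phi>) (parity (sf a b c d))"
  using parity_cong[OF group_act_sf[of n a b c d]] group_act_sf[of n a "- b" "- c" d]
  by (simp add: parity_sf eq_on_siegel_def pb_simps) (simp add: algebra_simps)

lemma DD_group_act:
  assumes "F \<in> superfunctions"
  shows "group_act (3/2) (s, g, \<phi>) (DD F) \<doteq> DD (group_act (1/2) (s, g, \<phi>) F)"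
    and "group_act (3/2) (s, g, \<phi>) (parity (DD F)) \<doteq> parity (DD (group_act (1/2) (s, g, \<phi>) F))"
proof -
  have DD: "group_act (3/2) (s, g, \<phi>) (DD F) \<doteq> DD (group_act (1/2) (s, g, \<phi>) F)"
    if hol: "F \<in> superfunctions" for F
  proof -
    obtain a b c d where F: "F \<doteq> sf a b c d" using superfunction_sf[OF hol] .
    show ?thesis
      using group_act_cong[OF DD_cong[OF F]] DD_group_act_sf[of a b c d] DD_cong[OF group_act_cong[OF F]]
      by (simp add: eq_on_siegel_def)
  qed
  show 1: "group_act (3/2) (s, g, \<phi>) (DD F) \<doteq> DD (group_act (1/2) (s, g, \<phi>) F)"
    by (rule DD[OF assms])
  obtain a b c d where G: "DD F \<doteq> sf a b c d"
    using superfunction_sf[OF even_operatorD(1)[OF even_operator_DD assms]] .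
  have "parity (group_act (3/2) (s, g, \<phi>) (sf a b c d)) \<doteq> group_act (3/2) (s, g, \<phi>) (parity (sf a b c d))"
    using group_act_parity_sf[of 3] by simp
  then have "group_act (3/2) (s, g, \<phi>) (parity (DD F)) \<doteq> parity (group_act (3/2) (s, g, \<phi>) (DD F))"
    using group_act_cong[OF parity_cong[OF G]] parity_cong[OF group_act_cong[OF G]]
    by (simp add: eq_on_siegel_def)
  also have "\<dots> \<doteq> parity (DD (group_act (1/2) (s, g, \<phi>) F))"
    by (rule parity_cong[OF 1])
  finally show "group_act (3/2) (s, g, \<phi>) (parity (DD F)) \<doteq> parity (DD (group_act (1/2) (s, g, \<phi>) F))" .
qed

end

lemma metaplecticI: "(s, g, \<phi>) \<in> OMp_even \<Longrightarrow> metaplectic g s \<phi>"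
  by (auto intro!: metaplectic.intro symplectic.intro metaplectic_axioms.intro simp: OMp_even_def)

lemma group_equivariant_DD: "group_equivariant (1/2) (3/2) DD"
  and group_equivariant_parity_DD: "group_equivariant (1/2) (3/2) (\<lambda>F. parity (DD F))"
  unfolding group_equivariant_def
  using metaplectic.DD_group_act[OF metaplecticI] by auto

theorem proposition3p4p6:
  shows "super_diff_op DD \<and> skew_invariant (1/2) (3/2) DD \<and>
         OMp_morphism (1/2) (3/2) (\<lambda>F. parity (DD F))"
  unfolding skew_invariant_def OMp_morphism_def
  using super_diff_op_DD even_operator_DD group_equivariant_DD DD_odd_act
    even_operator_parity_DD group_equivariant_parity_DD parity_DD_odd_act
    bracket_act_commute[OF even_operator_parity_DD parity_DD_odd_act]
  by blast

end
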